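(* Let $n \in \mathbb{N}$, let $M \subset \mathbb{R}^n$ be a compact connected smooth hypersurface (without boundary) and let $$\alpha(M):= \# \left\{\{x,y\}\subset M \ \middle|\ x \neq y, \ T_xM=T_yM=(x-y)^\perp \right\}.$$ Then $$\alpha(M) \geq \mathsf{TC}(M)-1.$$ In particular, there are at least $\mathsf{TC}(M)-1$ distinct unordered pairs of points $\{x,y\} \subset M$ which satisfy $T_xM =T_yM$.
   Context: Tangent spaces $T_xM$ are regarded as linear subspaces of $\mathbb{R}^n$, and $(x-y)^\perp$ is the orthogonal complement of $x-y$ with respect to the Euclidean inner product. For a path-connected space $X$, let $\pi\colon C^0([0,1],X)\to X\times X$, $\pi(\gamma)=(\gamma(0),\gamma(1))$ (compact-open topology on the path space). The topological complexity $\mathsf{TC}(X)$ is the smallest $k\in\mathbb{N}$ such that there is an open cover $U_1,\dots,U_k$ of $X\times X$ with each $U_i$ admitting a continuous local section of $\pi$ (unreduced convention: a contractible space has $\mathsf{TC}=1$). *)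

theory Defs
  imports "HOL-Analysis.Analysis"
begin

text \<open>
  Smooth maps between Euclidean spaces. The following notions are meant for open \<open>S\<close>:
  \<open>f\<close> is \<open>C\<^sup>k\<close> on \<open>S\<close> if it is differentiable there and every directional derivative
  is \<open>C\<^sup>k\<^sup>-\<^sup>1\<close>.
\<close>

primrec Ck_on :: "nat \<Rightarrow> 'a::euclidean_space set \<Rightarrow> ('a \<Rightarrow> 'b::euclidean_space) \<Rightarrow> bool" where
  "Ck_on 0 S f \<longleftrightarrow> continuous_on S f"
| "Ck_on (Suc k) S f \<longleftrightarrow>
     (\<forall>x\<in>S. f differentiable (at x)) \<and>
     (\<forall>v. Ck_on k S (\<lambda>x. frechet_derivative f (at x) v))"

definition smooth_on :: "'a::euclidean_space set \<Rightarrow> ('a \<Rightarrow> 'b::euclidean_space) \<Rightarrow> bool" where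
  "smooth_on S f \<longleftrightarrow> (\<forall>k. Ck_on k S f)"

definition diffeomorphism ::
  "'a::euclidean_space set \<Rightarrow> 'b::euclidean_space set \<Rightarrow> ('a \<Rightarrow> 'b) \<Rightarrow> ('b \<Rightarrow> 'a) \<Rightarrow> bool" where
  "diffeomorphism U V \<phi> \<psi> \<longleftrightarrow>
     open U \<and> open V \<and> homeomorphism U V \<phi> \<psi> \<and> smooth_on U \<phi> \<and> smooth_on V \<psi>"

text \<open>
  Embedded \<open>d\<close>-dimensional submanifolds without boundary, by slice charts: near each of its
  points \<open>M\<close> is straightened to a \<open>d\<close>-dimensional linear subspace \<open>L\<close>.
\<close>

definition smooth_submanifold :: "nat \<Rightarrow> 'a::euclidean_space set \<Rightarrow> bool" where
  "smooth_submanifold d M \<longleftrightarrow>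
     (\<forall>p\<in>M. \<exists>U V \<phi> \<psi> L.
        p \<in> U \<and> diffeomorphism U V \<phi> (\<psi> :: 'a \<Rightarrow> 'a) \<and>
        subspace L \<and> dim L = d \<and> \<phi> ` (M \<inter> U) = L \<inter> V)"

definition smooth_hypersurface :: "'a::euclidean_space set \<Rightarrow> bool" where
  "smooth_hypersurface M \<longleftrightarrow> smooth_submanifold (DIM('a) - 1) M"

text \<open>
  Velocity vectors at \<open>x\<close> of smooth curves in \<open>M\<close> through \<open>x\<close>; as a set of vectors based at
  the origin, this is a linear subspace when \<open>M\<close> is a submanifold.
\<close>

definition tangent_space :: "'a::euclidean_space set \<Rightarrow> 'a \<Rightarrow> 'a set" where
  "tangent_space M x =
     {v. \<exists>\<epsilon>>0. \<exists>\<gamma>::real \<Rightarrow> 'a.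
        smooth_on {-\<epsilon><..<\<epsilon>} \<gamma> \<and> \<gamma> ` {-\<epsilon><..<\<epsilon>} \<subseteq> M \<and>
        \<gamma> 0 = x \<and> (\<gamma> has_vector_derivative v) (at 0)}"

text \<open>
  The path space \<open>C\<^sup>0([0,1],X)\<close> with the compact-open topology. Paths are represented by
  functions that are \<^const>\<open>undefined\<close> outside \<open>[0,1]\<close>, so that each path has a unique
  representative.
\<close>

definition path_space :: "'a topology \<Rightarrow> (real \<Rightarrow> 'a) topology" where
  "path_space X =
     topology_generated_by
       {{\<gamma> \<in> extensional {0..1}. pathin X \<gamma> \<and> \<gamma> ` K \<subseteq> W} | K W.
          compact K \<and> K \<subseteq> {0..1} \<and> openin X W}"

definition admits_local_section :: "'a topology \<Rightarrow> ('a \<times> 'a) set \<Rightarrow> bool" where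
  "admits_local_section X U \<longleftrightarrow>
     (\<exists>s. continuous_map (subtopology (prod_topology X X) U) (path_space X) s \<and>
          (\<forall>z\<in>U. (s z 0, s z 1) = z))"

text \<open>
  Unreduced topological complexity; the value is \<open>\<infinity>\<close> if no finite cover exists.
\<close>

definition topological_complexity :: "'a topology \<Rightarrow> enat" where
  "topological_complexity X =
     Inf {enat k | k. \<exists>U :: nat \<Rightarrow> ('a \<times> 'a) set.
        (\<forall>i<k. openin (prod_topology X X) (U i) \<and> admits_local_section X (U i)) \<and>
        (\<Union>i<k. U i) = topspace (prod_topology X X)}"

definition ecard :: "'a set \<Rightarrow> enat" where
  "ecard A = (if finite A then enat (card A) else \<infinity>)"

definition double_normal_count :: "'a::euclidean_space set \<Rightarrow> enat" where
  "double_normal_count M =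
     ecard {{x, y} | x y. x \<in> M \<and> y \<in> M \<and> x \<noteq> y \<and>
              tangent_space M x = tangent_space M y \<and>
              tangent_space M y = {x - y}\<^sup>\<bottom>}"

end

theory Submission
  imports Defs
begin

text \<open>
  The distance function \<open>f (x, y) = dist x y\<close> on \<open>M \<times> M\<close> has, off the diagonal, exactly the ordered
  double normals as critical points. Near every other off-diagonal point a small push of \<open>x\<close> or \<open>y\<close>
  along \<open>M\<close>, cut off by a bump function, is a map of \<open>M \<times> M\<close> that is homotopic to the identity and
  lowers \<open>f\<close> wherever it moves anything. Composing finitely many pushes replaces the
  gradient flow: sublevel sets can be pushed down between critical values, and crossing a critical
  value costs one extra open set, a neighbourhood of the critical points of that value carrying a
  local section of the path fibration. Hence
  \<open>TC(M) \<le> 1 + #(positive critical values) \<le> 1 + \<alpha>(M)\<close>; both orderings of a pair lie at the same value.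
\<close>

section \<open>Motion planners and descent\<close>

text \<open>The estimate is of Lusternik-Schnirelmann type: one open set serves a whole critical
  level, because finitely many critical points have disjoint neighbourhoods and planners over
  disjoint open sets unite to one planner. The exception is the level 0, where the critical set is
  the entire diagonal; its planner is assembled from charts by compactness, and it accounts for the
  summand 1. What lets pushes replace a flow is the alternative in \<open>descends\<close>: a point
  is fixed or its value drops strictly. Hence no later push can undo an earlier one, and a composite
  moves every point that some factor moves. The existence of a descending g with g z \<noteq> z thus
  stands in for z being noncritical, and no vector field has to be globalised. Uniform drops come
  from attained minima on compact sets. If there are infinitely many double normals, the bound is
  trivial.\<close>

abbreviation homot :: "'a::topological_space set \<Rightarrow> 'b::topological_space set \<Rightarrow> ('a \<Rightarrow> 'b) \<Rightarrow> ('a \<Rightarrow> 'b) \<Rightarrow> bool"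
  where "homot S T f g \<equiv> homotopic_with_canon (\<lambda>_. True) S T f g"

lemma homotI:
  assumes "continuous_on ({0..1::real} \<times> S) h" "h ` ({0..1} \<times> S) \<subseteq> T"
    and "\<And>z. z \<in> S \<Longrightarrow> h (0, z) = f z" "\<And>z. z \<in> S \<Longrightarrow> h (1, z) = g z"
  shows "homot S T f g"
  by (subst homotopic_with) (use assms in \<open>auto simp: image_subset_iff_funcset intro!: exI[of _ h]\<close>)

lemma homotE:
  assumes "homot S T f g"
  obtains h where "continuous_on ({0..1::real} \<times> S) h" "h ` ({0..1} \<times> S) \<subseteq> T"
    "\<And>z. h (0, z) = f z" "\<And>z. h (1, z) = g z"
  using assms unfolding homotopic_with_def by (auto simp: image_subset_iff_funcset)

text \<open>Openness of both pieces makes the case distinction continuous. With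
  \<open>k = snd\<close> this extends a cut-off deformation of A by the identity on B.\<close>

lemma homot_glue:
  assumes A: "openin (top_of_set S) A" and B: "openin (top_of_set S) B" and S: "S = A \<union> B"
    and h: "continuous_on ({0..1} \<times> A) h" "h ` ({0..1} \<times> A) \<subseteq> T"
    and k: "continuous_on ({0..1} \<times> B) k" "k ` ({0..1} \<times> B) \<subseteq> T"
    and eq: "\<And>t z. t \<in> {0..1::real} \<Longrightarrow> z \<in> A \<Longrightarrow> z \<in> B \<Longrightarrow> h (t, z) = k (t, z)"
  shows "homot S T (\<lambda>z. if z \<in> A then h (0, z) else k (0, z))
                   (\<lambda>z. if z \<in> A then h (1, z) else k (1, z))"
proof (rule homotI)
  have "{0..1} \<times> S = {0..1::real} \<times> A \<union> {0..1} \<times> B" using S by auto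
  moreover have "openin (top_of_set ({0..1::real} \<times> S)) ({0..1} \<times> A)"
    "openin (top_of_set ({0..1::real} \<times> S)) ({0..1} \<times> B)"
    using A B by (auto intro: openin_Times)
  ultimately show "continuous_on ({0..1} \<times> S) (\<lambda>p. if snd p \<in> A then h p else k p)"
    using continuous_on_cases_local_open[of "{0..1::real} \<times> A" "{0..1} \<times> B" h k "\<lambda>p. snd p \<in> A"]
      h k eq by fastforce
  show "(\<lambda>p. if snd p \<in> A then h p else k p) ` ({0..1} \<times> S) \<subseteq> T"
    using h k S by (auto simp: image_subset_iff)
qed auto

text \<open>
  By currying, a homotopy over \<open>A\<close> between the two projections is a local section of the path
  fibration.
\<close>

definition motion_plannable :: "'a::topological_space set \<Rightarrow> ('a \<times> 'a) set \<Rightarrow> bool" where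
  "motion_plannable M A \<longleftrightarrow> homot A M fst snd"

text \<open>A relative form of topological complexity: the sets are open in M \<times> M and only
  have to cover A, so that A may be a closed sublevel set.\<close>

definition planner_cover :: "'a::topological_space set \<Rightarrow> nat \<Rightarrow> ('a \<times> 'a) set \<Rightarrow> bool" where
  "planner_cover M k A \<longleftrightarrow>
     (\<exists>U :: nat \<Rightarrow> ('a \<times> 'a) set.
        (\<forall>i<k. openin (top_of_set (M \<times> M)) (U i) \<and> motion_plannable M (U i)) \<and> A \<subseteq> (\<Union>i<k. U i))"

lemma motion_plannable_subset:
  "motion_plannable M B \<Longrightarrow> A \<subseteq> B \<Longrightarrow> motion_plannable M A"
  unfolding motion_plannable_def by (rule homotopic_with_subset_left)

text \<open>For z in A, follow the deformation from \<open>fst z\<close> to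
  \<open>fst (g z)\<close>, then the planner of B to \<open>snd (g z)\<close>, then the deformation
  backwards to \<open>snd z\<close>.\<close>

lemma motion_plannable_deform:
  assumes g: "homot A (M \<times> M) id g" and sub: "g ` A \<subseteq> B" and B: "motion_plannable M B"
  shows "motion_plannable M A"
proof -
  have fs: "continuous_on (M \<times> M) fst" "continuous_on (M \<times> M) snd"
    by (simp_all add: continuous_on_fst continuous_on_snd)
  have g': "continuous_on A g" using g homotopic_with_imp_continuous by blast
  have "homot A M (fst \<circ> id) (fst \<circ> g)"
    by (rule homotopic_with_compose_continuous_left[OF _ fs(1)]) (use g in auto)
  moreover have "homot A M (fst \<circ> g) (snd \<circ> g)"
    by (rule homotopic_with_compose_continuous_right[of _ _ B]) 
      (use B sub g' in \<open>auto simp: motion_plannable_def\<close>)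
  moreover have "homot A M (snd \<circ> id) (snd \<circ> g)"
    by (rule homotopic_with_compose_continuous_left[OF _ fs(2)]) (use g in auto)
  ultimately show ?thesis
    unfolding motion_plannable_def
    by (metis comp_id homotopic_with_symD homotopic_with_trans)
qed

lemma motion_plannable_Un:
  assumes "openin (top_of_set S) A" "openin (top_of_set S) B" "A \<inter> B = {}"
    and "motion_plannable M A" "motion_plannable M B"
  shows "motion_plannable M (A \<union> B)"
proof -
  have *: "openin (top_of_set (A \<union> B)) A" "openin (top_of_set (A \<union> B)) B"
    using assms(1,2) openin_subset_trans openin_imp_subset
    by (metis Un_subset_iff Un_upper1 Un_upper2)+
  obtain h where h: "continuous_on ({0..1::real} \<times> A) h" "h ` ({0..1} \<times> A) \<subseteq> M"
    "\<And>z. h (0, z) = fst z" "\<And>z. h (1, z) = snd z"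
    using assms(4) homotE unfolding motion_plannable_def by blast
  obtain k where k: "continuous_on ({0..1::real} \<times> B) k" "k ` ({0..1} \<times> B) \<subseteq> M"
    "\<And>z. k (0, z) = fst z" "\<And>z. k (1, z) = snd z"
    using assms(5) homotE unfolding motion_plannable_def by blast
  have "homot (A \<union> B) M (\<lambda>z. if z \<in> A then h (0, z) else k (0, z))
                       (\<lambda>z. if z \<in> A then h (1, z) else k (1, z))"
    by (rule homot_glue[OF * refl h(1,2) k(1,2)]) (use assms(3) in auto)
  then show ?thesis
    unfolding motion_plannable_def by (simp only: h(3,4) k(3,4) if_cancel)
qed

section \<open>Operations on planner covers\<close>

lemma planner_cover_mono:
  assumes "planner_cover M k B" "A \<subseteq> B" "k \<le> l"
  shows "planner_cover M l A"
proof -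
  obtain U where U: "\<And>i. i < k \<Longrightarrow> openin (top_of_set (M \<times> M)) (U i) \<and> motion_plannable M (U i)"
    "B \<subseteq> (\<Union>i<k. U i)"
    using assms(1) unfolding planner_cover_def by blast
  have e: "motion_plannable M {}"
    using homotopic_with_canon_on_empty[of M fst snd] by (simp add: motion_plannable_def)
  \<comment> \<open>Surplus indices get the empty set, over which any two maps are
    homotopic.\<close>
  define V where "V i = (if i < k then U i else {})" for i
  have "\<forall>i<l. openin (top_of_set (M \<times> M)) (V i) \<and> motion_plannable M (V i)"
    using U(1) e by (simp add: V_def)
  moreover have "A \<subseteq> (\<Union>i<l. V i)"
  proof
    fix z assume "z \<in> A"
    then obtain i where "i < k" "z \<in> U i" using U(2) assms(2) by blast
    then have "i < l" "z \<in> V i" using assms(3) by (auto simp: V_def)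
    then show "z \<in> (\<Union>i<l. V i)" by blast
  qed
  ultimately show ?thesis unfolding planner_cover_def by (intro exI[of _ V] conjI)
qed

lemma planner_cover_Suc:
  assumes "planner_cover M k A" "openin (top_of_set (M \<times> M)) W" "motion_plannable M W"
  shows "planner_cover M (Suc k) (A \<union> W)"
proof -
  obtain U where "\<forall>i<k. openin (top_of_set (M \<times> M)) (U i) \<and> motion_plannable M (U i)"
    "A \<subseteq> (\<Union>i<k. U i)"
    using assms(1) unfolding planner_cover_def by blast
  then show ?thesis
    unfolding planner_cover_def using assms(2,3)
    by (intro exI[of _ "U(k := W)"]) (auto simp: less_Suc_eq)
qed

text \<open>Preimages under g of the covering sets are open, and g deforms each preimage into its
  set. So a set that g moves into a lower sublevel set inherits the cover of the latter.\<close>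

lemma planner_cover_pullback:
  assumes g: "homot (M \<times> M) (M \<times> M) id g" and c: "planner_cover M k B"
    and A: "A \<subseteq> M \<times> M" "g ` A \<subseteq> B"
  shows "planner_cover M k A"
proof -
  let ?N = "M \<times> M"
  obtain U where U: "\<And>i. i < k \<Longrightarrow> openin (top_of_set ?N) (U i) \<and> motion_plannable M (U i)"
    "B \<subseteq> (\<Union>i<k. U i)"
    using c unfolding planner_cover_def by blast
  have g': "continuous_on ?N g" "g ` ?N \<subseteq> ?N"
    using g homotopic_with_imp_continuous homotopic_with_imp_subset2 by blast+
  have "openin (top_of_set ?N) (?N \<inter> g -` U i) \<and> motion_plannable M (?N \<inter> g -` U i)" if "i < k" for i
  proof
    show "openin (top_of_set ?N) (?N \<inter> g -` U i)"
      using continuous_openin_preimage[OF g'(1), of ?N "U i"] g'(2) U(1)[OF that] by blast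
    show "motion_plannable M (?N \<inter> g -` U i)"
      by (rule motion_plannable_deform[where g = g and B = "U i"])
        (use U(1)[OF that] g in \<open>auto intro: homotopic_with_subset_left\<close>)
  qed
  moreover have "A \<subseteq> (\<Union>i<k. ?N \<inter> g -` U i)"
  proof
    fix z assume z: "z \<in> A"
    then obtain i where "i < k" "g z \<in> U i" using A(2) U(2) by blast
    then show "z \<in> (\<Union>i<k. ?N \<inter> g -` U i)" using A(1) z by blast
  qed
  ultimately show ?thesis
    unfolding planner_cover_def by (intro exI[of _ "\<lambda>i. ?N \<inter> g -` U i"] conjI) simp_all
qed

section \<open>Descending maps: composition and compactness\<close>

definition descends :: "'a::topological_space set \<Rightarrow> ('a \<Rightarrow> real) \<Rightarrow> ('a \<Rightarrow> 'a) \<Rightarrow> bool" where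
  "descends N f g \<longleftrightarrow> homot N N id g \<and> (\<forall>z\<in>N. g z = z \<or> f (g z) < f z)"

lemma descends_le: "descends N f g \<Longrightarrow> z \<in> N \<Longrightarrow> f (g z) \<le> f z"
  by (auto simp: descends_def)

lemma descends_id: "descends N f id"
  by (simp add: descends_def)

lemma descends_comp:
  assumes "descends N f g" "descends N f h"
  shows "descends N f (h \<circ> g)"
proof -
  have g: "homot N N id g" and h: "homot N N id h" using assms by (auto simp: descends_def)
  have g': "continuous_on N g" "g ` N \<subseteq> N"
    using g homotopic_with_imp_continuous homotopic_with_imp_subset2 by blast+
  have "homot N N (id \<circ> g) (h \<circ> g)"
    by (rule homotopic_with_compose_continuous_right[of _ _ N]) (use h g' in auto)
  then have "homot N N id (h \<circ> g)" using homotopic_with_trans[OF g] by simp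
  then show ?thesis using assms g' unfolding descends_def
    by (auto simp: image_subset_iff) (metis order_less_trans)
qed

text \<open>Once some factor has moved z the value lies below f z, and the remaining factors cannot
  raise it; so the composite cannot return to z.\<close>

lemma descends_finite:
  assumes "finite F" "\<And>g. g \<in> F \<Longrightarrow> descends N f g"
  shows "\<exists>h. descends N f h \<and> (\<forall>z\<in>N. (\<exists>g\<in>F. g z \<noteq> z) \<longrightarrow> h z \<noteq> z)"
  using assms
proof (induction F)
  case empty
  then show ?case using descends_id by blast
next
  case (insert g F)
  then obtain h where h: "descends N f h" "\<And>z. z \<in> N \<Longrightarrow> (\<exists>g\<in>F. g z \<noteq> z) \<Longrightarrow> h z \<noteq> z"
    by blast
  have g: "descends N f g" using insert by auto
  have N: "h z \<in> N" if "z \<in> N" for z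
    using that h(1) homotopic_with_imp_subset2 unfolding descends_def by blast
  have "(g \<circ> h) z \<noteq> z" if z: "z \<in> N" and ex: "\<exists>k\<in>insert g F. k z \<noteq> z" for z
  proof (cases "h z = z")
    case True
    then show ?thesis using ex h(2)[OF z] by auto
  next
    case False
    then have "f (h z) < f z" using h(1) z by (auto simp: descends_def)
    moreover have "f (g (h z)) \<le> f (h z)"
      using descends_le[OF g N[OF z]] .
    ultimately show ?thesis by auto
  qed
  then show ?case using descends_comp[OF h(1) g] by blast
qed

text \<open>Being moved by a continuous map is an open condition, so finitely many of the given maps
  suffice to move every point of Q.\<close>

lemma descends_compact:
  fixes N :: "'a::euclidean_space set"
  assumes Q: "compact Q" "Q \<subseteq> N" and ex: "\<And>z. z \<in> Q \<Longrightarrow> \<exists>g. descends N f g \<and> g z \<noteq> z"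
  shows "\<exists>g. descends N f g \<and> (\<forall>z\<in>Q. f (g z) < f z)"
proof -
  obtain G where G: "\<And>z. z \<in> Q \<Longrightarrow> descends N f (G z) \<and> G z z \<noteq> z"
    using ex by metis
  define O' where "O' z = Q \<inter> (\<lambda>w. G z w - w) -` (- {0})" for z
  have "openin (top_of_set Q) (O' z)" if "z \<in> Q" for z
    unfolding O'_def
  proof (rule continuous_openin_preimage_gen)
    have "continuous_on N (G z)"
      using G[OF that] homotopic_with_imp_continuous unfolding descends_def by blast
    then show "continuous_on Q (\<lambda>w. G z w - w)"
      using Q(2) continuous_on_subset by (intro continuous_intros) blast
  qed auto
  moreover have "Q \<subseteq> \<Union>(O' ` Q)" using G by (auto simp: O'_def)
  ultimately obtain D where D: "D \<subseteq> O' ` Q" "finite D" "Q \<subseteq> \<Union>D"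
    using Q(1) unfolding compact_eq_openin_cover
    by (metis (no_types, lifting) image_iff)
  then obtain F where F: "F \<subseteq> Q" "finite F" "D = O' ` F"
    using finite_subset_image by metis
  obtain h where h: "descends N f h" "\<And>z. z \<in> N \<Longrightarrow> (\<exists>g\<in>G ` F. g z \<noteq> z) \<Longrightarrow> h z \<noteq> z"
    using descends_finite[of "G ` F" N f] G F by blast
  have "f (h z) < f z" if "z \<in> Q" for z
  proof -
    obtain w where "w \<in> F" "z \<in> O' w" using D(3) F(3) \<open>z \<in> Q\<close> by blast
    then have "h z \<noteq> z" using h(2) \<open>z \<in> Q\<close> Q(2) by (auto simp: O'_def)
    then show ?thesis using h(1) \<open>z \<in> Q\<close> Q(2) by (auto simp: descends_def)
  qed
  then show ?thesis using h(1) by blast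
qed

text \<open>There is no critical point in the slab between a and c, so one map lowers f there by at
  least some \<delta> > 0. Finitely many pullbacks along it carry the cover from a up to c.\<close>

lemma planner_cover_slab:
  fixes M :: "'a::euclidean_space set"
  assumes M: "compact M" and f: "continuous_on (M \<times> M) f" and "a \<le> c"
    and ex: "\<And>z. z \<in> M \<times> M \<Longrightarrow> a \<le> f z \<Longrightarrow> f z \<le> c \<Longrightarrow> \<exists>g. descends (M \<times> M) f g \<and> g z \<noteq> z"
    and cov: "planner_cover M k {z \<in> M \<times> M. f z \<le> a}"
  shows "planner_cover M k {z \<in> M \<times> M. f z \<le> c}"
proof -
  let ?N = "M \<times> M"
  define Q where "Q = ?N \<inter> f -` {a..c}"
  have N: "compact ?N" using M by (simp add: compact_Times)
  have Q: "compact Q" "Q \<subseteq> ?N"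
    unfolding Q_def using continuous_closedin_preimage[OF f, of "{a..c}"] N closedin_compact by auto
  obtain g where g: "descends ?N f g" "\<And>z. z \<in> Q \<Longrightarrow> f (g z) < f z"
    using descends_compact[OF Q, of f] ex by (auto simp: Q_def)
  have hg: "homot ?N ?N id g" using g by (simp add: descends_def)
  have g': "continuous_on ?N g" "g ` ?N \<subseteq> ?N"
    using hg homotopic_with_imp_continuous homotopic_with_imp_subset2 by blast+
  have contg: "continuous_on ?N (\<lambda>z. f z - f (g z))"
    by (intro continuous_intros f continuous_on_compose2[OF f g'])
  obtain \<delta> where \<delta>: "\<delta> > 0" "\<And>z. z \<in> Q \<Longrightarrow> f (g z) \<le> f z - \<delta>"
  proof (cases "Q = {}")
    case True
    then show ?thesis using that[of 1] by auto
  next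
    case False
    then obtain w where "w \<in> Q" "\<And>z. z \<in> Q \<Longrightarrow> f w - f (g w) \<le> f z - f (g z)"
      using continuous_attains_inf[OF Q(1) False continuous_on_subset[OF contg Q(2)]] by blast
    then show ?thesis using that[of "f w - f (g w)"] g(2)[of w] by (smt (verit))
  qed
  \<comment> \<open>The minimum with c confines the steps to the range where the drop \<delta> is
    known. Points below a need no drop, as g never raises f.\<close>
  have "planner_cover M k {z \<in> ?N. f z \<le> min c (a + real j * \<delta>)}" for j
  proof (induction j)
    case 0
    then show ?case using cov \<open>a \<le> c\<close> by simp
  next
    case (Suc j)
    show ?case
    proof (rule planner_cover_pullback[OF hg Suc])
      show "g ` {z \<in> ?N. f z \<le> min c (a + real (Suc j) * \<delta>)}
          \<subseteq> {z \<in> ?N. f z \<le> min c (a + real j * \<delta>)}"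
      proof
        fix w assume "w \<in> g ` {z \<in> ?N. f z \<le> min c (a + real (Suc j) * \<delta>)}"
        then obtain z where z: "z \<in> ?N" "f z \<le> c" "f z \<le> a + real (Suc j) * \<delta>" "w = g z" by auto
        have le: "f (g z) \<le> f z" using descends_le[OF g(1) z(1)] .
        have "f (g z) \<le> a + real j * \<delta>"
        proof (cases "z \<in> Q")
          case True
          then show ?thesis using \<delta>(2)[of z] z by (simp add: algebra_simps)
        next
          case False
          then have "f z < a" using z by (auto simp: Q_def)
          moreover have "0 \<le> real j * \<delta>" using \<delta> by simp
          ultimately show ?thesis using le by linarith
        qed
        then show "w \<in> {z \<in> ?N. f z \<le> min c (a + real j * \<delta>)}" using le z g'(2) by auto
      qed
    qed auto
  qed
  moreover obtain j where "c - a < real j * \<delta>" using reals_Archimedean3[OF \<delta>(1)] by blast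
  moreover from this have "min c (a + real j * \<delta>) = c" by simp
  ultimately show ?thesis by metis
qed

text \<open>W absorbs the critical points of level d. On the compact complement of W a single map
  carries a strip above d to strictly below d, where k sets suffice.\<close>

lemma planner_cover_level:
  fixes M :: "'a::euclidean_space set"
  assumes M: "compact M" and f: "continuous_on (M \<times> M) f"
    and W: "openin (top_of_set (M \<times> M)) W" "motion_plannable M W"
    and ex: "\<And>z. z \<in> M \<times> M \<Longrightarrow> f z = d \<Longrightarrow> z \<notin> W \<Longrightarrow> \<exists>g. descends (M \<times> M) f g \<and> g z \<noteq> z"
    and cov: "\<And>c. c < d \<Longrightarrow> planner_cover M k {z \<in> M \<times> M. f z \<le> c}"
  shows "\<exists>\<epsilon>>0. planner_cover M (Suc k) {z \<in> M \<times> M. f z \<le> d + \<epsilon>}"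
proof -
  let ?N = "M \<times> M"
  have N: "compact ?N" using M by (simp add: compact_Times)
  define R where "R = ?N - W"
  have "closedin (top_of_set ?N) R" using W(1) by (simp add: R_def closedin_def Diff_Diff_Int openin_imp_subset inf.absorb2)
  then have R: "compact R" "R \<subseteq> ?N" using N closedin_compact by (auto simp: R_def)
  define Q where "Q = R \<inter> f -` {d}"
  have Q: "compact Q" "Q \<subseteq> ?N"
    unfolding Q_def using continuous_closedin_preimage[OF continuous_on_subset[OF f R(2)], of "{d}"] R closedin_compact by auto
  obtain g where g: "descends ?N f g" "\<And>z. z \<in> Q \<Longrightarrow> f (g z) < f z"
    using descends_compact[OF Q, of f] ex by (auto simp: Q_def R_def)
  have hg: "homot ?N ?N id g" using g by (simp add: descends_def)
  have g': "continuous_on ?N g" "g ` ?N \<subseteq> ?N"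
    using hg homotopic_with_imp_continuous homotopic_with_imp_subset2 by blast+
  \<comment> \<open>One minimum yields both the height of the strip and the depth reached: if e
    \<le> m z and f z \<le> d + e/2, the first entry is below e, so f (g z) \<le> d - e. On R, m z
    \<le> 0 would force f z = d = f (g z), contradicting the drop on Q.\<close>
  define m where "m z = max (f z - d) (d - f (g z))" for z
  have contm: "continuous_on ?N m"
    unfolding m_def by (intro continuous_intros f continuous_on_compose2[OF f g'])
  have pos: "m z > 0" if "z \<in> R" for z
  proof (rule ccontr)
    assume "\<not> m z > 0"
    then have "f z \<le> d" "d \<le> f (g z)" by (auto simp: m_def)
    moreover have "f (g z) \<le> f z"
      using descends_le[OF g(1)] R(2) that by blast
    ultimately have "z \<in> Q" using that by (auto simp: Q_def)
    then show False using g(2)[of z] \<open>f z \<le> d\<close> \<open>d \<le> f (g z)\<close> by linarith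
  qed
  obtain e where e: "e > 0" "\<And>z. z \<in> R \<Longrightarrow> e \<le> m z"
  proof (cases "R = {}")
    case True
    then show ?thesis using that[of 1] by auto
  next
    case False
    then obtain w where "w \<in> R" "\<And>z. z \<in> R \<Longrightarrow> m w \<le> m z"
      using continuous_attains_inf[OF R(1) False continuous_on_subset[OF contm R(2)]] by blast
    then show ?thesis using that[of "m w"] pos by blast
  qed
  have "planner_cover M k {z \<in> R. f z \<le> d + e/2}"
  proof (rule planner_cover_pullback[OF hg cov[of "d - e"]])
    show "g ` {z \<in> R. f z \<le> d + e/2} \<subseteq> {z \<in> ?N. f z \<le> d - e}"
    proof (rule image_subsetI)
      fix z assume "z \<in> {z \<in> R. f z \<le> d + e/2}"
      then have z: "z \<in> R" "f z \<le> d + e/2" by auto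
      have "f (g z) \<le> d - e"
        using e(2)[OF z(1)] z(2) e(1) by (auto simp: m_def max_def split: if_splits)
      then show "g z \<in> {z \<in> ?N. f z \<le> d - e}" using z R(2) g'(2) by blast
    qed
  qed (use e R in auto)
  from planner_cover_Suc[OF this W]
  have "planner_cover M (Suc k) {z \<in> ?N. f z \<le> d + e/2}"
    by (rule planner_cover_mono) (auto simp: R_def)
  then show ?thesis using e(1) half_gt_zero by blast
qed

text \<open>Induction on the number of values of D up to c. Let d be the largest of them: every
  level below d has fewer, crossing d costs one set, and the rest of the way to c is a slab without
  values of D.\<close>

proposition planner_cover_sublevel:
  fixes M :: "'a::euclidean_space set"
  assumes M: "compact M" and f: "continuous_on (M \<times> M) f"
    and D: "finite D"
    and lev: "\<And>d. d \<in> D \<Longrightarrow> \<exists>W. openin (top_of_set (M \<times> M)) W \<and> motion_plannable M W \<and>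
         (\<forall>z\<in>M \<times> M. f z = d \<longrightarrow> z \<in> W \<or> (\<exists>g. descends (M \<times> M) f g \<and> g z \<noteq> z))"
    and reg: "\<And>z. z \<in> M \<times> M \<Longrightarrow> f z \<notin> D \<Longrightarrow> \<exists>g. descends (M \<times> M) f g \<and> g z \<noteq> z"
  shows "planner_cover M (card {d \<in> D. d \<le> c}) {z \<in> M \<times> M. f z \<le> c}"
proof (induction "card {d \<in> D. d \<le> c}" arbitrary: c rule: less_induct)
  case less
  let ?E = "{d \<in> D. d \<le> c}"
  show ?case
  proof (cases "?E = {}")
    case True
    have "compact (f ` (M \<times> M))" using M f by (intro compact_continuous_image) (auto simp: compact_Times)
    then obtain B where B: "\<And>z. z \<in> M \<times> M \<Longrightarrow> \<bar>f z\<bar> \<le> B"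
      using compact_imp_bounded bounded_real by (metis imageI)
    \<comment> \<open>This level lies below all values of f, so its sublevel set is empty and is
      covered by no sets at all.\<close>
    define a where "a = min c (- B - 1)"
    have e: "{z \<in> M \<times> M. f z \<le> a} = {}" using B by (force simp: a_def)
    show ?thesis
    proof (rule planner_cover_slab[OF M f])
      show "a \<le> c" by (simp add: a_def)
      show "planner_cover M (card ?E) {z \<in> M \<times> M. f z \<le> a}"
        unfolding e by (auto simp: planner_cover_def True)
    qed (use True in \<open>auto intro!: reg\<close>)
  next
    case False
    define d where "d = Max ?E"
    have d: "d \<in> D" "d \<le> c" "\<And>d'. d' \<in> D \<Longrightarrow> d' \<le> c \<Longrightarrow> d' \<le> d"
      using Max_in[of ?E] Max_ge[of ?E] D False by (auto simp: d_def)
    define k where "k = card ?E - 1"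
    have k: "card ?E = Suc k" using D False by (simp add: k_def card_gt_0_iff)
    obtain W where W: "openin (top_of_set (M \<times> M)) W" "motion_plannable M W"
      "\<And>z. z \<in> M \<times> M \<Longrightarrow> f z = d \<Longrightarrow> z \<in> W \<or> (\<exists>g. descends (M \<times> M) f g \<and> g z \<noteq> z)"
      using lev[OF d(1)] by blast
    have cov: "planner_cover M k {z \<in> M \<times> M. f z \<le> b}" if "b < d" for b
    proof -
      have "{d' \<in> D. d' \<le> b} \<subset> ?E" using that d by force
      then have "card {d' \<in> D. d' \<le> b} < card ?E" using D by (intro psubset_card_mono) auto
      then show ?thesis using less[of b] planner_cover_mono[OF less[of b] order_refl] k by simp
    qed
    obtain \<epsilon> where \<epsilon>: "\<epsilon> > 0" "planner_cover M (Suc k) {z \<in> M \<times> M. f z \<le> d + \<epsilon>}"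
      using planner_cover_level[OF M f W(1,2) _ cov] W(3) by blast
    \<comment> \<open>The level c may already lie in the strip above d. Otherwise a = d +
      \<epsilon>, and no value of D remains between a and c.\<close>
    define a where "a = min c (d + \<epsilon>)"
    have reg': "\<exists>g. descends (M \<times> M) f g \<and> g z \<noteq> z"
      if "z \<in> M \<times> M" "a \<le> f z" "f z \<le> c" "a < c" for z
      using that \<epsilon>(1) d(3)[of "f z"] by (intro reg) (auto simp: a_def min_def split: if_splits)
    have cova: "planner_cover M (Suc k) {z \<in> M \<times> M. f z \<le> a}"
      by (rule planner_cover_mono[OF \<epsilon>(2)]) (auto simp: a_def)
    show ?thesis
    proof (cases "a < c")
      case True
      show ?thesis unfolding k
        by (rule planner_cover_slab[OF M f _ _ cova]) (use True reg' in auto)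
    next
      case False
      then have "a = c" by (simp add: a_def)
      then show ?thesis using cova k by simp
    qed
  qed
qed

text \<open>This is the currying direction for the compact-open topology. Continuity is tested on
  subbasic sets, where compactness of K makes the bad parameters a closed set.\<close>

lemma motion_plannable_imp_local_section:
  fixes M :: "'a::euclidean_space set"
  assumes U: "openin (top_of_set (M \<times> M)) U" and p: "motion_plannable M U"
  shows "admits_local_section (top_of_set M) U"
proof -
  obtain h where h: "continuous_on ({0..1::real} \<times> U) h" "h ` ({0..1} \<times> U) \<subseteq> M"
    "\<And>z. h (0, z) = fst z" "\<And>z. h (1, z) = snd z"
    using p homotE unfolding motion_plannable_def by blast
  define s where "s z = restrict (\<lambda>t. h (t, z)) {0..1}" for z
  have UM: "U \<subseteq> M \<times> M" using U openin_imp_subset by blast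
  have top: "subtopology (prod_topology (top_of_set M) (top_of_set M)) U = top_of_set U"
    using UM by (simp add: subtopology_subtopology inf.absorb2)
  have path: "pathin (top_of_set M) (s z)" if "z \<in> U" for z
  proof -
    have "continuous_on {0..1} (\<lambda>t. h (t, z))"
      using that by (intro continuous_on_compose2[OF h(1)] continuous_intros) auto
    then have "continuous_on {0..1} (s z)"
      by (rule continuous_on_eq) (simp add: s_def)
    then show ?thesis using h(2) that by (auto simp: pathin_def s_def image_subset_iff)
  qed
  have "continuous_map (top_of_set U) (path_space (top_of_set M)) s"
    unfolding path_space_def
  proof (rule continuous_on_generated_topo)
    fix B assume "B \<in> {{\<gamma> \<in> extensional {0..1}. pathin (top_of_set M) \<gamma> \<and> \<gamma> ` K \<subseteq> W} | K W.
          compact K \<and> K \<subseteq> {0..1} \<and> openin (top_of_set M) W}"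
    then obtain K W where B: "B = {\<gamma> \<in> extensional {0..1}. pathin (top_of_set M) \<gamma> \<and> \<gamma> ` K \<subseteq> W}"
      and K: "compact K" "K \<subseteq> {0..1::real}" and W: "openin (top_of_set M) W" by blast
    \<comment> \<open>These z have a path leaving W at some time in K. The set is the projection,
      along the compact K, of a closed set.\<close>
    define C where "C = {z. \<exists>t. t \<in> K \<and> (t, z) \<in> K \<times> U \<inter> h -` (M - W)}"
    have "closedin (top_of_set U) C"
      unfolding C_def
    proof (rule closedin_compact_projection[OF K(1)])
      have sub: "K \<times> U \<subseteq> {0..1} \<times> U" using K by auto
      show "closedin (top_of_set (K \<times> U)) (K \<times> U \<inter> h -` (M - W))"
        by (rule continuous_closedin_preimage_gen[where T = M])
          (use continuous_on_subset[OF h(1) sub] h(2) sub W in \<open>auto simp: image_subset_iff\<close>)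
    qed
    moreover have "s -` B \<inter> topspace (top_of_set U) = U - C"
      using path K h(2) by (auto simp: B C_def s_def image_subset_iff subset_iff)
    ultimately show "openin (top_of_set U) (s -` B \<inter> topspace (top_of_set U))"
      by (simp add: closedin_def)
  next
    \<comment> \<open>The choice of the empty K with W = M shows that the subbasis covers all paths
      in M.\<close>
    have "s z \<in> {\<gamma> \<in> extensional {0..1}. pathin (top_of_set M) \<gamma> \<and> \<gamma> ` {} \<subseteq> M}" if "z \<in> U" for z
      using path[OF that] by (auto simp: s_def)
    moreover have "openin (top_of_set M) M" by simp
    ultimately have mem: "s z \<in> \<Union> {{\<gamma> \<in> extensional {0..1}. pathin (top_of_set M) \<gamma> \<and> \<gamma> ` K \<subseteq> W} | K W.
          compact K \<and> K \<subseteq> {0..1} \<and> openin (top_of_set M) W}" if "z \<in> U" for z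
      using that compact_empty empty_subsetI by blast
    show "s ` topspace (top_of_set U) \<subseteq> \<Union> {{\<gamma> \<in> extensional {0..1}. pathin (top_of_set M) \<gamma> \<and> \<gamma> ` K \<subseteq> W} | K W.
          compact K \<and> K \<subseteq> {0..1} \<and> openin (top_of_set M) W}"
      by (intro image_subsetI mem) simp
  qed
  then show ?thesis
    unfolding admits_local_section_def top using h(3,4)
    by (intro exI[of _ s]) (auto simp: s_def)
qed

lemma topological_complexity_le:
  fixes M :: "'a::euclidean_space set"
  assumes "planner_cover M k (M \<times> M)"
  shows "topological_complexity (top_of_set M) \<le> enat k"
proof -
  obtain U where U: "\<And>i. i < k \<Longrightarrow> openin (top_of_set (M \<times> M)) (U i) \<and> motion_plannable M (U i)"
    "M \<times> M \<subseteq> (\<Union>i<k. U i)"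
    using assms unfolding planner_cover_def by blast
  have "(\<Union>i<k. U i) = M \<times> M" using U openin_imp_subset by blast
  then show ?thesis
    unfolding topological_complexity_def
    using U motion_plannable_imp_local_section by (intro Inf_lower) (auto; blast)
qed

section \<open>Planners near points and near the diagonal\<close>

text \<open>What the planners use of the manifold: line segments in the convex set T turn into paths
  in M. T will be a piece of a linear subspace, so in general it is not open in the ambient
  space.\<close>

definition convex_charts :: "'a::euclidean_space set \<Rightarrow> bool" where
  "convex_charts M \<longleftrightarrow>
     (\<forall>a\<in>M. \<exists>C T \<phi> (\<psi> :: 'a \<Rightarrow> 'a).
        openin (top_of_set M) C \<and> a \<in> C \<and> convex T \<and> homeomorphism C T \<phi> \<psi>)"

text \<open>L \<inter> V may fail to be convex; cutting the chart down to the preimage of a ball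
  gives a convex image.\<close>

lemma slice_chart_ball:
  assumes d: "diffeomorphism U V \<phi> \<psi>" and im: "\<phi> ` (M \<inter> U) = L \<inter> V" and r: "ball b r \<subseteq> V"
  shows "openin (top_of_set M) (M \<inter> (U \<inter> \<phi> -` ball b r))"
    and "homeomorphism (M \<inter> (U \<inter> \<phi> -` ball b r)) (L \<inter> ball b r) \<phi> \<psi>"
proof -
  have h: "homeomorphism U V \<phi> \<psi>" "open U" using d by (auto simp: diffeomorphism_def)
  have "open (U \<inter> \<phi> -` ball b r)"
    using h by (intro continuous_open_preimage) (auto simp: homeomorphism_def)
  then show "openin (top_of_set M) (M \<inter> (U \<inter> \<phi> -` ball b r))"
    by (rule openin_open_Int)
  have "\<phi> ` (M \<inter> (U \<inter> \<phi> -` ball b r)) = L \<inter> ball b r"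
  proof
    show "\<phi> ` (M \<inter> (U \<inter> \<phi> -` ball b r)) \<subseteq> L \<inter> ball b r" using im by auto
    show "L \<inter> ball b r \<subseteq> \<phi> ` (M \<inter> (U \<inter> \<phi> -` ball b r))"
    proof
      fix y assume y: "y \<in> L \<inter> ball b r"
      then have "y \<in> \<phi> ` (M \<inter> U)" using im r by blast
      then show "y \<in> \<phi> ` (M \<inter> (U \<inter> \<phi> -` ball b r))" using y by blast
    qed
  qed
  then show "homeomorphism (M \<inter> (U \<inter> \<phi> -` ball b r)) (L \<inter> ball b r) \<phi> \<psi>"
    using r by (intro homeomorphism_of_subsets[OF h(1)]) auto
qed

lemma smooth_submanifold_convex_charts:
  assumes "smooth_submanifold d M"
  shows "convex_charts M"
  unfolding convex_charts_def
proof
  fix a assume a: "a \<in> M"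
  obtain U V \<phi> \<psi> L where U: "a \<in> U" "diffeomorphism U V \<phi> (\<psi> :: 'a \<Rightarrow> 'a)"
    "subspace L" "\<phi> ` (M \<inter> U) = L \<inter> V"
    using assms a unfolding smooth_submanifold_def by meson
  have "open V" "\<phi> a \<in> V" using U by (auto simp: diffeomorphism_def homeomorphism_def)
  then obtain r where r: "r > 0" "ball (\<phi> a) r \<subseteq> V" using open_contains_ball by blast
  have "convex (L \<inter> ball (\<phi> a) r)"
    using U(3) by (intro convex_Int subspace_imp_convex convex_ball)
  then show "\<exists>C T \<phi> (\<psi> :: 'a \<Rightarrow> 'a).
        openin (top_of_set M) C \<and> a \<in> C \<and> convex T \<and> homeomorphism C T \<phi> \<psi>"
    using slice_chart_ball[OF U(2,4) r(2)] a U(1) r(1)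
    by (intro exI[of _ "M \<inter> (U \<inter> \<phi> -` ball (\<phi> a) r)"] exI[of _ "L \<inter> ball (\<phi> a) r"]
        exI[of _ \<phi>] exI[of _ \<psi>]) auto
qed

section \<open>Planners near finitely many points\<close>

lemma convex_charts_contractible:
  assumes "convex_charts M" "a \<in> M"
  obtains C where "openin (top_of_set M) C" "a \<in> C" "contractible C"
proof -
  obtain C T \<phi> and \<psi> :: "'a \<Rightarrow> 'a"
    where C: "openin (top_of_set M) C" "a \<in> C" "convex T" "homeomorphism C T \<phi> \<psi>"
    using assms unfolding convex_charts_def by blast
  have "T homeomorphic C" using C(4) homeomorphic_def homeomorphic_sym by blast
  then show ?thesis using that C homeomorphic_contractible convex_imp_contractible by blast
qed

text \<open>Each point has a path connected neighbourhood, so path components are open, and a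
  connected M has only one.\<close>

lemma convex_charts_path_connected:
  assumes M: "convex_charts M" "connected M"
  shows "path_connected M"
proof -
  have "path_component M a b" if ab: "a \<in> M" "b \<in> M" for a b
  proof (rule connected_equivalence_relation[OF M(2) ab])
    fix c assume "c \<in> M"
    then obtain C where C: "openin (top_of_set M) C" "c \<in> C" "contractible C"
      using convex_charts_contractible[OF M(1)] by blast
    then have "path_component M c x" if "x \<in> C" for x
      using contractible_imp_path_connected path_connected_component openin_imp_subset
        path_component_of_subset that by metis
    then show "\<exists>T. openin (top_of_set M) T \<and> c \<in> T \<and> (\<forall>x\<in>T. path_component M c x)"
      using C by blast
  qed (auto intro: path_component_sym path_component_trans)
  then show ?thesis by (simp add: path_connected_component)
qed

text \<open>For (x, y) near (a, b): contract x to a inside A, follow a fixed path p from a to b,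
  then run the contraction of B from y to b backwards.\<close>

lemma motion_plannable_point:
  assumes M: "convex_charts M" "path_connected M" and z: "z \<in> M \<times> M"
  obtains W where "openin (top_of_set (M \<times> M)) W" "z \<in> W" "motion_plannable M W"
proof -
  obtain a b where ab: "z = (a, b)" "a \<in> M" "b \<in> M" using z by blast
  obtain A where A: "openin (top_of_set M) A" "a \<in> A" "contractible A"
    using convex_charts_contractible[OF M(1) ab(2)] by blast
  obtain B where B: "openin (top_of_set M) B" "b \<in> B" "contractible B"
    using convex_charts_contractible[OF M(1) ab(3)] by blast
  have AB: "A \<subseteq> M" "B \<subseteq> M" using A B openin_imp_subset by blast+
  obtain p where p: "path p" "path_image p \<subseteq> M" "pathstart p = a" "pathfinish p = b"
    using M(2) ab unfolding path_connected_def by blast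
  have "homot (A \<times> B) A fst (\<lambda>_. a)"
    using A by (intro homotopic_into_contractible) (auto simp: continuous_on_fst)
  then have 1: "homot (A \<times> B) M fst (\<lambda>_. a)" using AB(1) homotopic_with_subset_right by blast
  have "homot (A \<times> B) B snd (\<lambda>_. b)"
    using B by (intro homotopic_into_contractible) (auto simp: continuous_on_snd)
  then have 2: "homot (A \<times> B) M snd (\<lambda>_. b)" using AB(2) homotopic_with_subset_right by blast
  have "homot (A \<times> B) M (\<lambda>_. a) (\<lambda>_. b)"
  proof (rule homotI)
    show "continuous_on ({0..1} \<times> A \<times> B) (p \<circ> fst)"
      using p(1) unfolding path_def
      by (intro continuous_on_compose continuous_on_fst continuous_on_id)
        (auto elim!: continuous_on_subset)
  qed (use p in \<open>auto simp: path_image_def pathstart_def pathfinish_def\<close>)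
  then have "motion_plannable M (A \<times> B)"
    unfolding motion_plannable_def using 1 2 homotopic_with_trans homotopic_with_symD by metis
  then show ?thesis using that[of "A \<times> B"] A B ab by (simp add: openin_Times)
qed

lemma motion_plannable_finite:
  assumes M: "convex_charts M" "path_connected M" and F: "finite F" "F \<subseteq> M \<times> M"
  shows "\<exists>W. openin (top_of_set (M \<times> M)) W \<and> F \<subseteq> W \<and> motion_plannable M W"
  using F
proof (induction F)
  case empty
  have "motion_plannable M {}"
    using homotopic_with_canon_on_empty[of M fst snd] by (simp add: motion_plannable_def)
  then show ?case by (intro exI[of _ "{}"]) simp
next
  case (insert z F)
  then obtain V where V: "openin (top_of_set (M \<times> M)) V" "F \<subseteq> V" "motion_plannable M V" by blast
  obtain W where W: "openin (top_of_set (M \<times> M)) W" "z \<in> W" "motion_plannable M W"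
    using motion_plannable_point[OF M] insert.prems by blast
  obtain d where d: "d > 0" "\<And>w. w \<in> F \<Longrightarrow> w \<noteq> z \<Longrightarrow> d \<le> dist z w"
    using finite_set_avoid[OF insert.hyps(1)] by blast
  \<comment> \<open>d bounds the distance from z to F from below, so the closed ball of radius d/2
    misses F and separates the two planners.\<close>
  let ?V = "V \<inter> - cball z (d/2)" and ?W = "W \<inter> ball z (d/2)"
  have o: "openin (top_of_set (M \<times> M)) ?V" "openin (top_of_set (M \<times> M)) ?W"
    using V(1) W(1) by (auto intro: openin_Int_open)
  have far: "w \<notin> cball z (d/2)" if "w \<in> F" for w
  proof -
    have "d \<le> dist z w" using d(2) that insert.hyps(2) by blast
    then show ?thesis using d(1) unfolding mem_cball by linarith
  qed
  have "motion_plannable M ?V" "motion_plannable M ?W"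
    by (rule motion_plannable_subset[OF V(3)] motion_plannable_subset[OF W(3)], simp)+
  then have "motion_plannable M (?V \<union> ?W)"
    by (intro motion_plannable_Un[OF o]) auto
  moreover have "z \<in> ball z (d/2)" using d(1) by simp
  then have "insert z F \<subseteq> ?V \<union> ?W"
    using V(2) W(2) far by blast
  ultimately show ?case using o openin_Un by (intro exI[of _ "?V \<union> ?W"]) blast
qed

text \<open>
  A deformation of a neighbourhood of the diagonal that never moves the second coordinate, preserves
  the diagonal, and moves \<open>(x, y)\<close> to \<open>(y, y)\<close> when \<open>y \<in> B\<close>. As \<open>y\<close> stays put, two such deformations can be
  composed, which globalises the straight-line deformation of a single chart.
\<close>

definition diagonal_pull :: "'a::topological_space set \<Rightarrow> 'a set \<Rightarrow> bool" where
  "diagonal_pull M B \<longleftrightarrow>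
     (\<exists>W g. openin (top_of_set (M \<times> M)) W \<and> (\<forall>x\<in>M. (x, x) \<in> W) \<and> homot W (M \<times> M) id g \<and>
        (\<forall>z\<in>W. snd (g z) = snd z \<and> (snd z \<in> B \<or> fst z = snd z \<longrightarrow> fst (g z) = snd z)))"

lemma diagonal_pull_empty: "diagonal_pull M {}"
  unfolding diagonal_pull_def by (intro exI[of _ "M \<times> M"] exI[of _ id]) auto

lemma diagonal_pull_Un:
  assumes "diagonal_pull M A" "diagonal_pull M B"
  shows "diagonal_pull M (A \<union> B)"
proof -
  obtain V g where V: "openin (top_of_set (M \<times> M)) V" "\<And>x. x \<in> M \<Longrightarrow> (x, x) \<in> V"
    "homot V (M \<times> M) id g" "\<And>z. z \<in> V \<Longrightarrow> snd (g z) = snd z"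
    "\<And>z. z \<in> V \<Longrightarrow> snd z \<in> A \<or> fst z = snd z \<Longrightarrow> fst (g z) = snd z"
    using assms(1) unfolding diagonal_pull_def by blast
  obtain W h where W: "openin (top_of_set (M \<times> M)) W" "\<And>x. x \<in> M \<Longrightarrow> (x, x) \<in> W"
    "homot W (M \<times> M) id h" "\<And>z. z \<in> W \<Longrightarrow> snd (h z) = snd z"
    "\<And>z. z \<in> W \<Longrightarrow> snd z \<in> B \<or> fst z = snd z \<Longrightarrow> fst (h z) = snd z"
    using assms(2) unfolding diagonal_pull_def by blast
  have g: "continuous_on V g" "g ` V \<subseteq> M \<times> M"
    using V(3) homotopic_with_imp_continuous homotopic_with_imp_subset2 by blast+
  let ?X = "V \<inter> g -` W"
  have o: "openin (top_of_set (M \<times> M)) ?X"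
    using continuous_openin_preimage[OF g(1) _ W(1)] g(2) V(1) openin_trans
    by (metis image_subset_iff_funcset)
  \<comment> \<open>Fixing the diagonal keeps it inside the domain of the composite.\<close>
  have gd: "g (x, x) = (x, x)" if "x \<in> M" for x
    using V(4,5)[OF V(2)[OF that]] by (simp add: prod_eq_iff)
  have "homot ?X (M \<times> M) id g" using V(3) by (rule homotopic_with_subset_left) auto
  moreover have "homot ?X (M \<times> M) (id \<circ> g) (h \<circ> g)"
    by (rule homotopic_with_compose_continuous_right[of _ _ W])
      (use W(3) g(1) in \<open>auto elim: continuous_on_subset\<close>)
  ultimately have "homot ?X (M \<times> M) id (h \<circ> g)"
    using homotopic_with_trans by fastforce
  moreover have "\<forall>x\<in>M. (x, x) \<in> ?X" using V(2) W(2) gd by simp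
  \<comment> \<open>If \<open>snd z\<close> lies in A, then g z is on the diagonal already and h
    preserves that; if it lies in B, then h does the pulling, since g kept the second
    coordinate.\<close>
  moreover have "\<forall>z\<in>?X. snd ((h \<circ> g) z) = snd z \<and>
      (snd z \<in> A \<union> B \<or> fst z = snd z \<longrightarrow> fst ((h \<circ> g) z) = snd z)"
    using V(4,5) W(4,5) by auto
  ultimately show ?thesis
    unfolding diagonal_pull_def using o by (intro exI[of _ ?X] exI[of _ "h \<circ> g"] conjI)
qed

text \<open>In the chart, x slides along the segment towards y by the fraction \<beta> y. The
  cut-off depends on the fixed coordinate y alone and vanishes for y far from a, which allows
  extension by the identity.\<close>

lemma diagonal_pull_chart:
  assumes M: "convex_charts M" and a: "a \<in> M"
  shows "\<exists>B. openin (top_of_set M) B \<and> a \<in> B \<and> diagonal_pull M B"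
proof -
  obtain C T \<phi> and \<psi> :: "'a \<Rightarrow> 'a"
    where C: "openin (top_of_set M) C" "a \<in> C" and T: "convex T" and h: "homeomorphism C T \<phi> \<psi>"
    using M a unfolding convex_charts_def by blast
  obtain \<eta> where \<eta>: "\<eta> > 0" "cball a \<eta> \<inter> M \<subseteq> C" and CM: "C \<subseteq> M"
    using C unfolding openin_contains_cball by blast
  \<comment> \<open>A piecewise linear bump: 1 up to distance \<eta>/2 from a, and 0 from distance
    \<eta> on.\<close>
  define \<beta> where "\<beta> y = max 0 (min 1 (2 - 2 * dist a y / \<eta>))" for y
  have \<beta>: "0 \<le> \<beta> y" "\<beta> y \<le> 1" for y by (auto simp: \<beta>_def)
  have \<beta>0: "\<beta> y = 0" if "y \<notin> cball a \<eta>" for y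
    using that \<eta> by (auto simp: \<beta>_def field_simps)
  have \<beta>1: "\<beta> y = 1" if "y \<in> ball a (\<eta>/2)" for y
    using that \<eta> by (auto simp: \<beta>_def field_simps)
  define A where "A = C \<times> C"
  \<comment> \<open>A and D together contain the diagonal: a point of M within \<eta> of a lies in
    C.\<close>
  define D where "D = M \<times> (M \<inter> - cball a \<eta>)"
  define H where "H = (\<lambda>(t::real, x, y). (\<psi> ((1 - t * \<beta> y) *\<^sub>R \<phi> x + (t * \<beta> y) *\<^sub>R \<phi> y), y))"
  have hom: "continuous_on C \<phi>" "continuous_on T \<psi>" "\<And>x. x \<in> C \<Longrightarrow> \<phi> x \<in> T"
    "\<And>x. x \<in> T \<Longrightarrow> \<psi> x \<in> C" "\<And>x. x \<in> C \<Longrightarrow> \<psi> (\<phi> x) = x"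
    using h by (auto simp: homeomorphism_def)
  have inT: "(1 - t * \<beta> y) *\<^sub>R \<phi> x + (t * \<beta> y) *\<^sub>R \<phi> y \<in> T"
    if "t \<in> {0..1}" "x \<in> C" "y \<in> C" for t x y
    using that \<beta>[of y] hom(3) T by (intro convexD_alt) (auto intro: mult_le_one)
  have oA: "openin (top_of_set (M \<times> M)) A"
    using C by (simp add: A_def openin_Times)
  have oD: "openin (top_of_set (M \<times> M)) D"
    unfolding D_def by (intro openin_Times openin_subtopology_self openin_open_Int) (auto simp: open_Compl)
  have sub: "A \<subseteq> A \<union> D" "D \<subseteq> A \<union> D" "A \<union> D \<subseteq> M \<times> M"
    using CM by (auto simp: A_def D_def)
  have oA': "openin (top_of_set (A \<union> D)) A" and oD': "openin (top_of_set (A \<union> D)) D"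
    using openin_subset_trans[OF oA sub(1,3)] openin_subset_trans[OF oD sub(2,3)] by auto
  have contH: "continuous_on ({0..1} \<times> A) H"
    unfolding H_def split_def \<beta>_def A_def
    by (intro continuous_intros continuous_on_compose2[OF hom(2)] continuous_on_compose2[OF hom(1)])
      (use \<eta> inT in \<open>auto simp: \<beta>_def\<close>)
  have "homot (A \<union> D) (M \<times> M) (\<lambda>z. if z \<in> A then H (0, z) else snd (0::real, z))
      (\<lambda>z. if z \<in> A then H (1, z) else snd (1::real, z))"
  proof (rule homot_glue[OF oA' oD' refl contH])
    show "H ` ({0..1} \<times> A) \<subseteq> M \<times> M"
      using hom(4) inT CM by (fastforce simp: H_def A_def)
    show "continuous_on ({0..1} \<times> D) snd" by (simp add: continuous_on_snd)
    show "snd ` ({0..1} \<times> D) \<subseteq> M \<times> M" using sub by auto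
    show "H (t, z) = snd (t, z)" if "t \<in> {0..1}" "z \<in> A" "z \<in> D" for t z
      using that \<beta>0 hom(5) by (auto simp: H_def A_def D_def)
  qed
  then have hg: "homot (A \<union> D) (M \<times> M) id (\<lambda>z. if z \<in> A then H (1, z) else z)"
    by (rule homotopic_with_eq) (auto simp: H_def A_def hom(5))
  define B where "B = M \<inter> ball a (\<eta>/2)"
  have "diagonal_pull M B"
    unfolding diagonal_pull_def
  proof (intro exI conjI)
    show "openin (top_of_set (M \<times> M)) (A \<union> D)" using oA oD by blast
    show "\<forall>x\<in>M. (x, x) \<in> A \<union> D" using \<eta>(2) by (auto simp: A_def D_def)
    show "homot (A \<union> D) (M \<times> M) id (\<lambda>z. if z \<in> A then H (1, z) else z)" by (rule hg)
    have fix': "(1 - b) *\<^sub>R v + b *\<^sub>R v = v" for b and v :: 'a by (simp add: algebra_simps)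
    have "y \<notin> B" if "(x, y) \<in> D" for x y using that \<eta>(1) by (auto simp: D_def B_def)
    then show "\<forall>z\<in>A \<union> D. snd (if z \<in> A then H (1, z) else z) = snd z \<and>
       (snd z \<in> B \<or> fst z = snd z \<longrightarrow> fst (if z \<in> A then H (1, z) else z) = snd z)"
      using \<beta>1 hom(5) by (auto simp: H_def A_def B_def fix')
  qed
  moreover have "openin (top_of_set M) B" "a \<in> B" using a \<eta>(1) by (auto simp: B_def)
  ultimately show ?thesis by blast
qed

text \<open>Composing the pulls of finitely many charts covering M deforms a neighbourhood into the
  diagonal, where \<open>fst\<close> and \<open>snd\<close> agree and constant paths are a
  planner.\<close>

lemma motion_plannable_diagonal:
  assumes M: "convex_charts M" "compact M"
  obtains W where "openin (top_of_set (M \<times> M)) W" "\<And>x. x \<in> M \<Longrightarrow> (x, x) \<in> W" "motion_plannable M W"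
proof -
  obtain B where B: "\<And>a. a \<in> M \<Longrightarrow> openin (top_of_set M) (B a) \<and> a \<in> B a \<and> diagonal_pull M (B a)"
    using diagonal_pull_chart[OF M(1)] by metis
  have "(\<forall>c\<in>B ` M. openin (top_of_set M) c) \<and> M \<subseteq> \<Union>(B ` M)" using B by blast
  then obtain D where D: "D \<subseteq> B ` M" "finite D" "M \<subseteq> \<Union>D"
    using M(2) unfolding compact_eq_openin_cover by metis
  have "diagonal_pull M (\<Union>D)"
    using D(2,1)
  proof (induction D)
    case (insert X D)
    then show ?case using diagonal_pull_Un[of M X "\<Union>D"] B by auto
  qed (simp add: diagonal_pull_empty)
  then obtain W g where W: "openin (top_of_set (M \<times> M)) W" "\<And>x. x \<in> M \<Longrightarrow> (x, x) \<in> W"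
    "homot W (M \<times> M) id g" "\<And>z. z \<in> W \<Longrightarrow> snd (g z) = snd z"
    "\<And>z. z \<in> W \<Longrightarrow> snd z \<in> \<Union>D \<Longrightarrow> fst (g z) = snd z"
    unfolding diagonal_pull_def by blast
  have "motion_plannable M {(x, x) | x. x \<in> M}"
    unfolding motion_plannable_def
    by (rule homotopic_with_equal) (auto simp: continuous_on_fst)
  moreover have "g ` W \<subseteq> {(x, x) | x. x \<in> M}"
  proof
    fix w assume "w \<in> g ` W"
    then obtain z where z: "z \<in> W" "w = g z" by blast
    then have "snd z \<in> M" using W(1) openin_imp_subset by fastforce
    then have "fst w = snd z" "snd w = snd z" using W(4,5)[OF z(1)] D(3) z(2) by auto
    then show "w \<in> {(x, x) | x. x \<in> M}" using \<open>snd z \<in> M\<close> by (cases w) auto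
  qed
  ultimately have "motion_plannable M W" using motion_plannable_deform[OF W(3)] by blast
  then show ?thesis using that W(1,2) by blast
qed

section \<open>Tangent spaces of hypersurfaces\<close>

lemma smooth_on_differentiable:
  "smooth_on S f \<Longrightarrow> x \<in> S \<Longrightarrow> f differentiable (at x)"
  unfolding smooth_on_def by (metis Ck_on.simps(2))

lemma smooth_on_continuous_derivative:
  "smooth_on S f \<Longrightarrow> continuous_on S (\<lambda>x. frechet_derivative f (at x) v)"
  unfolding smooth_on_def by (metis Ck_on.simps)

lemma Ck_on_cong:
  assumes "open S" "\<And>x. x \<in> S \<Longrightarrow> f x = g x" "Ck_on k S f"
  shows "Ck_on k S g"
  using assms(2,3)
proof (induction k arbitrary: f g)
  case 0
  then show ?case using continuous_on_cong by force
next
  case (Suc k)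
  have d: "(g has_derivative frechet_derivative f (at x)) (at x)" if "x \<in> S" for x
    using Suc.prems that assms(1)
    by (auto simp: frechet_derivative_works[symmetric]
        intro!: has_derivative_transform_within_open[of f _ x UNIV S g])
  then have "g differentiable (at x)" if "x \<in> S" for x
    using that differentiable_def by blast
  moreover have "Ck_on k S (\<lambda>x. frechet_derivative g (at x) v)" for v
  proof (rule Suc.IH[of "\<lambda>x. frechet_derivative f (at x) v"])
    show "frechet_derivative f (at x) v = frechet_derivative g (at x) v" if "x \<in> S" for x
      by (rule fun_cong[OF frechet_derivative_at[OF d[OF that]]])
  qed (use Suc.prems(2) in simp)
  ultimately show ?case by simp
qed

text \<open>The derivative in t is a directional derivative of f restricted to the same line, so the
  induction closes. It shows that images of lines under inverse charts are smooth curves.\<close>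

lemma Ck_on_line:
  fixes f :: "'a::euclidean_space \<Rightarrow> 'b::euclidean_space"
  assumes I: "open I" "\<And>t::real. t \<in> I \<Longrightarrow> c + t *\<^sub>R u \<in> V" and f: "Ck_on k V f"
  shows "Ck_on k I (\<lambda>t. f (c + t *\<^sub>R u))"
  using f
proof (induction k arbitrary: f)
  case 0
  then show ?case
    using I(2) by (auto intro!: continuous_on_compose2[of V f] continuous_intros)
next
  case (Suc k)
  have d: "((\<lambda>t. f (c + t *\<^sub>R u)) has_derivative (\<lambda>s. frechet_derivative f (at (c + t *\<^sub>R u)) (s *\<^sub>R u))) (at t)"
    if "t \<in> I" for t
  proof -
    have "(f has_derivative frechet_derivative f (at (c + t *\<^sub>R u))) (at (c + t *\<^sub>R u))"
      using Suc.prems I(2)[OF that] by (simp add: frechet_derivative_works[symmetric])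
    moreover have "((\<lambda>t. c + t *\<^sub>R u) has_derivative (\<lambda>s. s *\<^sub>R u)) (at t)"
      by (auto intro!: derivative_eq_intros)
    ultimately show ?thesis by (rule has_derivative_compose[rotated])
  qed
  have "Ck_on k I (\<lambda>t. frechet_derivative (\<lambda>t. f (c + t *\<^sub>R u)) (at t) s)" for s
  proof (rule Ck_on_cong[OF I(1)])
    show "Ck_on k I (\<lambda>t. frechet_derivative f (at (c + t *\<^sub>R u)) (s *\<^sub>R u))"
      using Suc.prems by (intro Suc.IH) simp
  qed (simp add: frechet_derivative_at[OF d, symmetric])
  moreover have "(\<lambda>t. f (c + t *\<^sub>R u)) differentiable (at t)" if "t \<in> I" for t
    using d[OF that] differentiable_def by blast
  ultimately show ?case by simp
qed

section \<open>Tangent spaces computed in slice charts\<close>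

lemma diffeomorphism_sym: "diffeomorphism U V \<phi> \<psi> \<Longrightarrow> diffeomorphism V U \<psi> \<phi>"
  unfolding diffeomorphism_def using homeomorphism_sym by blast

lemma diffeomorphism_derivative:
  assumes "diffeomorphism U V \<phi> \<psi>" "a \<in> U"
  shows "(\<phi> has_derivative frechet_derivative \<phi> (at a)) (at a)"
  using assms smooth_on_differentiable frechet_derivative_works
  unfolding diffeomorphism_def by blast

lemma diffeomorphism_derivative_inverse:
  assumes d: "diffeomorphism U V \<phi> \<psi>" and a: "a \<in> U"
  shows "frechet_derivative \<psi> (at (\<phi> a)) (frechet_derivative \<phi> (at a) v) = v"
proof -
  have h: "homeomorphism U V \<phi> \<psi>" "open U" using d by (auto simp: diffeomorphism_def)
  then have "\<phi> a \<in> V" using a by (auto simp: homeomorphism_def)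
  then have "((\<lambda>x. \<psi> (\<phi> x)) has_derivative
      (\<lambda>v. frechet_derivative \<psi> (at (\<phi> a)) (frechet_derivative \<phi> (at a) v))) (at a)"
    by (intro has_derivative_compose[OF diffeomorphism_derivative[OF d a]
          diffeomorphism_derivative[OF diffeomorphism_sym[OF d]]])
  then have "((\<lambda>x. x) has_derivative
      (\<lambda>v. frechet_derivative \<psi> (at (\<phi> a)) (frechet_derivative \<phi> (at a) v))) (at a)"
    by (rule has_derivative_transform_within_open[OF _ h(2) a]) (use h in \<open>auto simp: homeomorphism_def\<close>)
  from has_derivative_unique[OF this has_derivative_ident] show ?thesis by (rule fun_cong)
qed

lemma slice_inverse_mem:
  assumes d: "diffeomorphism U V \<phi> \<psi>" and im: "\<phi> ` (M \<inter> U) = L \<inter> V"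
    and y: "y \<in> L" "y \<in> V"
  shows "\<psi> y \<in> M"
proof -
  have "y \<in> \<phi> ` (M \<inter> U)" unfolding im using y by simp
  then show ?thesis using d by (auto simp: diffeomorphism_def homeomorphism_def)
qed

text \<open>Lines in L are mapped by \<psi> to smooth curves in M, which gives one inclusion.
  Conversely the chart carries a curve in M into L, and a linear subspace contains the velocities of
  its curves.\<close>

lemma tangent_space_slice:
  fixes M :: "'a::euclidean_space set"
  assumes a: "a \<in> M" "a \<in> U" and d: "diffeomorphism U V \<phi> \<psi>" and L: "subspace L"
    and im: "\<phi> ` (M \<inter> U) = L \<inter> V"
  shows "tangent_space M a = frechet_derivative \<psi> (at (\<phi> a)) ` L"
proof -
  define b where "b = \<phi> a"
  let ?\<phi>' = "frechet_derivative \<phi> (at a)" and ?\<psi>' = "frechet_derivative \<psi> (at b)"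
  have h: "homeomorphism U V \<phi> \<psi>" "open U" "open V" "smooth_on V \<psi>"
    using d by (auto simp: diffeomorphism_def)
  have hom: "\<And>x. x \<in> U \<Longrightarrow> \<phi> x \<in> V" "\<And>x. x \<in> V \<Longrightarrow> \<psi> x \<in> U" "\<And>x. x \<in> U \<Longrightarrow> \<psi> (\<phi> x) = x"
    using h(1) by (auto simp: homeomorphism_def)
  have b: "b \<in> V" "b \<in> L" using a im by (auto simp: b_def hom)
  note psiM = slice_inverse_mem[OF d im]
  have D\<phi>: "(\<phi> has_derivative ?\<phi>') (at a)" using diffeomorphism_derivative[OF d a(2)] .
  have D\<psi>: "(\<psi> has_derivative ?\<psi>') (at b)"
    using diffeomorphism_derivative[OF diffeomorphism_sym[OF d] b(1)] .
  have "?\<psi>' u \<in> tangent_space M a" if u: "u \<in> L" for u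
  proof -
    obtain r where r: "r > 0" "ball b r \<subseteq> V" using h(3) b(1) open_contains_ball by blast
    \<comment> \<open>The summand 1 keeps e positive for u = 0; for t of modulus below e the norm of
      t u stays below r.\<close>
    define e where "e = r / (norm u + 1)"
    have e: "e > 0" using r(1) by (simp add: e_def add_nonneg_pos)
    have V: "b + t *\<^sub>R u \<in> V" if "t \<in> {-e<..<e}" for t
    proof -
      have "\<bar>t\<bar> * norm u \<le> \<bar>t\<bar> * (norm u + 1)" by (intro mult_left_mono) auto
      also have "\<dots> < r"
        using that pos_less_divide_eq[of "norm u + 1" "\<bar>t\<bar>" r]
        by (auto simp: e_def add_nonneg_pos)
      finally show ?thesis using r(2) by (auto simp: dist_norm subset_iff)
    qed
    have "smooth_on {-e<..<e} (\<lambda>t. \<psi> (b + t *\<^sub>R u))"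
      unfolding smooth_on_def
    proof
      fix k
      show "Ck_on k {-e<..<e} (\<lambda>t. \<psi> (b + t *\<^sub>R u))"
        by (rule Ck_on_line[where V = V]) (use h(4) V in \<open>auto simp: smooth_on_def\<close>)
    qed
    moreover have "(\<lambda>t. \<psi> (b + t *\<^sub>R u)) ` {-e<..<e} \<subseteq> M"
      using V L b(2) u by (intro image_subsetI psiM subspace_add[OF L] subspace_scale[OF L]) auto
    moreover have "\<psi> (b + 0 *\<^sub>R u) = a" using hom(3) a by (simp add: b_def)
    moreover have "((\<lambda>t. \<psi> (b + t *\<^sub>R u)) has_vector_derivative ?\<psi>' u) (at 0)"
    proof -
      have "((\<lambda>t. b + t *\<^sub>R u) has_vector_derivative u) (at 0)"
        by (auto intro!: derivative_eq_intros)
      from vector_derivative_diff_chain_within[OF this, of \<psi> ?\<psi>'] D\<psi>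
      show ?thesis by (simp add: o_def has_derivative_at_withinI)
    qed
    ultimately show ?thesis unfolding tangent_space_def using e by blast
  qed
  moreover have "v \<in> ?\<psi>' ` L" if v: "v \<in> tangent_space M a" for v
  proof -
    obtain e \<gamma> where g: "e > 0" "\<gamma> ` {-e<..<e} \<subseteq> M" "\<gamma> (0::real) = a"
      "(\<gamma> has_vector_derivative v) (at 0)"
      using v unfolding tangent_space_def by blast
    \<comment> \<open>Membership in L is tested against normal vectors w: along the curve, w is
      orthogonal to the chart image for small t, so the derivative of this inner product is
      0.\<close>
    have "w \<bullet> ?\<phi>' v = 0" if w: "w \<in> L\<^sup>\<bottom>" for w
    proof -
      have "((\<phi> \<circ> \<gamma>) has_vector_derivative ?\<phi>' v) (at 0)"
        by (rule vector_derivative_diff_chain_within[OF g(4)])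
          (use D\<phi> g(3) in \<open>auto intro: has_derivative_at_withinI\<close>)
      then have 1: "((\<lambda>t. w \<bullet> \<phi> (\<gamma> t)) has_vector_derivative w \<bullet> ?\<phi>' v) (at 0)"
        using bounded_linear.has_vector_derivative[OF bounded_linear_inner_right] by (fastforce simp: o_def)
      have "isCont \<gamma> 0" using g(4) has_vector_derivative_continuous by blast
      then have "\<exists>T. open T \<and> 0 \<in> T \<and> (\<forall>t\<in>T. \<gamma> t \<in> U)"
        unfolding continuous_at_open using h(2) a(2) g(3) by simp
      then obtain T where T: "open T" "0 \<in> T" "\<And>t. t \<in> T \<Longrightarrow> \<gamma> t \<in> U"
        by auto
      have zero: "w \<bullet> \<phi> (\<gamma> t) = 0" if "t \<in> T \<inter> {-e<..<e}" for t
      proof -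
        have "\<gamma> t \<in> M \<inter> U" using that T(3) g(2) by auto
        then have "\<phi> (\<gamma> t) \<in> L" using im by (metis IntD1 imageI)
        then show ?thesis using w by (auto simp: orthogonal_comp_def orthogonal_def inner_commute)
      qed
      have "((\<lambda>t. 0) has_vector_derivative w \<bullet> ?\<phi>' v) (at 0)"
        by (rule has_vector_derivative_transform_within_open[OF 1, of "T \<inter> {-e<..<e}"])
          (use T g(1) zero in auto)
      then show ?thesis using vector_derivative_unique_at has_vector_derivative_const by blast
    qed
    then have "?\<phi>' v \<in> L\<^sup>\<bottom>\<^sup>\<bottom>" by (simp add: orthogonal_comp_def orthogonal_def)
    then have "?\<phi>' v \<in> L" using orthogonal_comp_self[OF L] by simp
    moreover have "?\<psi>' (?\<phi>' v) = v"
      using diffeomorphism_derivative_inverse[OF d a(2)] by (simp add: b_def)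
    ultimately show ?thesis by (metis imageI)
  qed
  ultimately show ?thesis unfolding b_def by blast
qed

lemma hypersurface_slice:
  fixes M :: "'a::euclidean_space set"
  assumes "smooth_hypersurface M" "a \<in> M"
  obtains U V \<phi> L and \<psi> :: "'a \<Rightarrow> 'a" where "a \<in> U" "diffeomorphism U V \<phi> \<psi>"
    "subspace L" "dim L = DIM('a) - 1" "\<phi> ` (M \<inter> U) = L \<inter> V"
proof -
  have "\<exists>U V \<phi> (\<psi> :: 'a \<Rightarrow> 'a) L. a \<in> U \<and> diffeomorphism U V \<phi> \<psi> \<and>
      subspace L \<and> dim L = DIM('a) - 1 \<and> \<phi> ` (M \<inter> U) = L \<inter> V"
    using assms(1) unfolding smooth_hypersurface_def smooth_submanifold_def
    by (rule bspec[OF _ assms(2)])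
  then show ?thesis using that by (elim exE conjE)
qed

text \<open>The inverse chart has an injective derivative, so the tangent space has dimension
  \<open>DIM('a) - 1\<close>; contained in a hyperplane of that dimension, it equals it.\<close>

lemma tangent_space_hyperplane:
  fixes M :: "'a::euclidean_space set"
  assumes M: "smooth_hypersurface M" "a \<in> M" and c: "c \<noteq> 0"
    and perp: "\<And>v. v \<in> tangent_space M a \<Longrightarrow> v \<bullet> c = 0"
  shows "tangent_space M a = {c}\<^sup>\<bottom>"
proof -
  obtain U V \<phi> L and \<psi> :: "'a \<Rightarrow> 'a" where s: "a \<in> U" "diffeomorphism U V \<phi> \<psi>"
    "subspace L" "dim L = DIM('a) - 1" "\<phi> ` (M \<inter> U) = L \<inter> V"
    by (rule hypersurface_slice[OF M])
  let ?\<psi>' = "frechet_derivative \<psi> (at (\<phi> a))"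
  have h: "\<phi> a \<in> V" "\<psi> (\<phi> a) = a"
    using s(1,2) by (auto simp: diffeomorphism_def homeomorphism_def)
  note d' = diffeomorphism_sym[OF s(2)]
  have lin: "linear ?\<psi>'"
    using diffeomorphism_derivative[OF d' h(1)] has_derivative_linear by blast
  have "inj ?\<psi>'"
    using diffeomorphism_derivative_inverse[OF d' h(1)] by (metis injI)
  then have "dim (?\<psi>' ` L) = dim L"
    using lin by (intro dim_image_eq) (auto elim: inj_on_subset)
  then have "dim (tangent_space M a) = dim {x. c \<bullet> x = 0}"
    using tangent_space_slice[OF M(2) s(1,2,3,5)] s(4) dim_hyperplane[OF c] by simp
  moreover have "subspace (tangent_space M a)"
    using tangent_space_slice[OF M(2) s(1,2,3,5)] linear_subspace_image[OF lin s(3)] by simp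
  moreover have "tangent_space M a \<subseteq> {x. c \<bullet> x = 0}"
    using perp by (auto simp: inner_commute)
  ultimately have "tangent_space M a = {x. c \<bullet> x = 0}"
    by (intro subspace_dim_equal) (auto simp: subspace_hyperplane)
  then show ?thesis by (simp add: orthogonal_comp_def orthogonal_def)
qed

section \<open>Pushing off non-critical points\<close>

text \<open>If v is not orthogonal to x0 - y0, moving x along v or -v shortens the distance to first
  order. By continuity of the derivative one chart direction u works for all (x, y) near (x0, y0),
  so translating x by a cut-off multiple of u is a push.\<close>

lemma descends_push:
  fixes M :: "'a::euclidean_space set"
  assumes M: "smooth_hypersurface M" and x0: "x0 \<in> M" and y0: "y0 \<in> M"
    and v: "v \<in> tangent_space M x0" "v \<bullet> (x0 - y0) \<noteq> 0"
  shows "\<exists>g. descends (M \<times> M) (\<lambda>z. dist (fst z) (snd z)) g \<and> g (x0, y0) \<noteq> (x0, y0)"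
proof -
  obtain U V \<phi> L and \<psi> :: "'a \<Rightarrow> 'a" where s: "x0 \<in> U" "diffeomorphism U V \<phi> \<psi>"
    "subspace L" "\<phi> ` (M \<inter> U) = L \<inter> V"
    by (rule hypersurface_slice[OF M x0])
  note d' = diffeomorphism_sym[OF s(2)]
  let ?D = "\<lambda>\<xi>. frechet_derivative \<psi> (at \<xi>)"
  define b where "b = \<phi> x0"
  have h: "homeomorphism U V \<phi> \<psi>" "open U" "open V" "smooth_on V \<psi>"
    using s(2) by (auto simp: diffeomorphism_def)
  have hom: "\<And>x. x \<in> U \<Longrightarrow> \<phi> x \<in> V" "\<And>x. x \<in> V \<Longrightarrow> \<psi> x \<in> U" "\<And>x. x \<in> U \<Longrightarrow> \<psi> (\<phi> x) = x"
    "continuous_on U \<phi>" "continuous_on V \<psi>"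
    using h(1) by (auto simp: homeomorphism_def)
  have b: "b \<in> V" "\<psi> b = x0" using s(1) hom by (auto simp: b_def)
  note psiM = slice_inverse_mem[OF s(2,4)]
  have D\<psi>: "(\<psi> has_derivative ?D \<xi>) (at \<xi>)" if "\<xi> \<in> V" for \<xi>
    using diffeomorphism_derivative[OF d' that] .
  have lin: "linear (?D \<xi>)" if "\<xi> \<in> V" for \<xi>
    using D\<psi>[OF that] has_derivative_linear by blast
  obtain w where w: "w \<in> L" "v = ?D b w"
    using v(1) tangent_space_slice[OF x0 s(1,2,3,4)] by (auto simp: b_def)
  \<comment> \<open>The sign points towards y0, and the normalisation makes a chart displacement q u
    have length q for q \<ge> 0.\<close>
  define u where "u = (- sgn (v \<bullet> (x0 - y0)) / norm w) *\<^sub>R w"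
  have "w \<noteq> 0"
    using v(2) w(2) linear_0[OF lin[OF b(1)]] by auto
  then have u: "u \<in> L" "norm u = 1"
    unfolding u_def using v(2) subspace_scale[OF s(3) w(1)] by (blast, simp add: sgn_if)
  have "?D b u = (- sgn (v \<bullet> (x0 - y0)) / norm w) *\<^sub>R v"
    unfolding u_def w(2) by (rule linear_cmul[OF lin[OF b(1)]])
  then have neg: "?D b u \<bullet> (\<psi> b - y0) < 0"
    using \<open>w \<noteq> 0\<close> v(2) b(2) by (simp add: sgn_if)
  \<comment> \<open>Half the derivative of the squared distance from \<psi> \<xi> to y in direction
    u.\<close>
  define G where "G = (\<lambda>(\<xi>, y). ?D \<xi> u \<bullet> (\<psi> \<xi> - y))"
  have contG: "continuous_on (V \<times> UNIV) G"
    unfolding G_def split_def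
    by (intro continuous_intros continuous_on_compose2[OF hom(5)]
        continuous_on_compose2[OF smooth_on_continuous_derivative[OF h(4)]]) auto
  have "open ((V \<times> UNIV) \<inter> G -` {..<0})"
    using contG h(3) by (intro continuous_open_preimage open_Times) auto
  moreover have "(b, y0) \<in> (V \<times> UNIV) \<inter> G -` {..<0}" using b neg by (simp add: G_def)
  ultimately obtain A B where AB: "open A" "open B" "b \<in> A" "y0 \<in> B"
    "A \<times> B \<subseteq> (V \<times> UNIV) \<inter> G -` {..<0}"
    by (metis open_prod_elim mem_Sigma_iff)
  obtain r1 r2 where r12: "r1 > 0" "ball b r1 \<subseteq> A" "r2 > 0" "ball y0 r2 \<subseteq> B"
    using AB(1-4) open_contains_ball by metis
  define r where "r = min r1 r2"
  have r: "r > 0" "ball b r \<subseteq> A" "ball y0 r \<subseteq> B" using r12 by (auto simp: r_def)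
  have rV: "ball b r \<subseteq> V" using r(2) AB(4,5) by blast
  have Gneg: "?D \<xi> u \<bullet> (\<psi> \<xi> - y) < 0" if "\<xi> \<in> ball b r" "y \<in> ball y0 r" for \<xi> y
  proof -
    have "(\<xi>, y) \<in> A \<times> B" using that r(2,3) by blast
    then have "(\<xi>, y) \<in> G -` {..<0}" using AB(5) by blast
    then show ?thesis by (simp add: G_def)
  qed
  \<comment> \<open>Half the radius is reserved for the displacement, which is at most \<eta> \<le>
    r/2.\<close>
  define C where "C = M \<inter> (U \<inter> \<phi> -` ball b (r/2))"
  have oC: "openin (top_of_set M) C"
    unfolding C_def using subset_ball[of "r/2" r b] rV r(1)
    by (intro slice_chart_ball(1)[OF s(2,4)]) simp
  have x0C: "x0 \<in> C" using x0 s(1) r(1) by (simp add: C_def b_def)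
  obtain \<eta>' where \<eta>': "\<eta>' > 0" "cball x0 \<eta>' \<inter> M \<subseteq> C"
    using oC x0C unfolding openin_contains_cball by blast
  define \<eta> where "\<eta> = min \<eta>' (r/2)"
  have \<eta>: "\<eta> > 0" "\<eta> \<le> r/2" "cball x0 \<eta> \<inter> M \<subseteq> C" using \<eta>' r(1) by (auto simp: \<eta>_def)
  have CM: "C \<subseteq> M" by (auto simp: C_def)
  \<comment> \<open>Both cut-off and step length. It is at most \<eta>, it vanishes for x outside
    the ball of radius \<eta>, and where it is positive, y is so close to y0 that G is negative
    along the step.\<close>
  define \<beta> where "\<beta> x y = max 0 (\<eta> - dist x0 x - dist y0 y)" for x y
  have \<beta>: "0 \<le> \<beta> x y" "\<beta> x y \<le> \<eta>" for x y
    unfolding \<beta>_def using \<eta>(1) zero_le_dist[of x0 x] zero_le_dist[of y0 y] by linarith+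
  define N where "N = C \<times> M"
  define E where "E = (M \<inter> - cball x0 \<eta>) \<times> M"
  define H where "H = (\<lambda>(t::real, x, y). (\<psi> (\<phi> x + (t * \<beta> x y) *\<^sub>R u), y))"
  have inb: "\<phi> x + q *\<^sub>R u \<in> ball b r" "\<phi> x + q *\<^sub>R u \<in> L" if "x \<in> C" "0 \<le> q" "q \<le> \<eta>" for x q
  proof -
    have "dist b (\<phi> x + q *\<^sub>R u) \<le> dist b (\<phi> x) + norm (q *\<^sub>R u)"
      using dist_triangle[of b "\<phi> x + q *\<^sub>R u" "\<phi> x"] by (simp add: dist_norm)
    also have "\<dots> < r" using that \<eta>(2) u(2) by (simp add: C_def)
    finally show "\<phi> x + q *\<^sub>R u \<in> ball b r" by simp
    have "\<phi> x \<in> L" using that s(4) by (auto simp: C_def)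
    then show "\<phi> x + q *\<^sub>R u \<in> L" using u(1) s(3) by (simp add: subspace_add subspace_scale)
  qed
  have inb': "\<phi> x + (t * \<beta> x y) *\<^sub>R u \<in> ball b r" "\<phi> x + (t * \<beta> x y) *\<^sub>R u \<in> L"
    if "x \<in> C" "t \<in> {0..1}" for x y t
    using that inb[of x "t * \<beta> x y"] \<beta>[of x y] mult_left_le_one_le[of "\<beta> x y" t] by auto
  have oN: "openin (top_of_set (M \<times> M)) N" unfolding N_def using oC by (simp add: openin_Times)
  have oE: "openin (top_of_set (M \<times> M)) E"
    unfolding E_def by (intro openin_Times openin_subtopology_self openin_open_Int) (auto simp: open_Compl)
  have NE: "M \<times> M = N \<union> E" using \<eta>(3) CM by (auto simp: N_def E_def)
  have contH: "continuous_on ({0..1} \<times> N) H"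
    unfolding H_def split_def \<beta>_def N_def
    by (intro continuous_intros continuous_on_compose2[OF hom(5)] continuous_on_compose2[OF hom(4)])
      (use inb' rV in \<open>auto simp: \<beta>_def C_def\<close>)
  have "homot (M \<times> M) (M \<times> M) (\<lambda>z. if z \<in> N then H (0, z) else snd (0::real, z))
      (\<lambda>z. if z \<in> N then H (1, z) else snd (1::real, z))"
  proof (rule homot_glue[OF oN oE NE contH])
    show "H ` ({0..1} \<times> N) \<subseteq> M \<times> M"
      using inb' rV by (auto simp: H_def N_def intro!: psiM)
    show "continuous_on ({0..1} \<times> E) snd" by (simp add: continuous_on_snd)
    show "snd ` ({0..1} \<times> E) \<subseteq> M \<times> M" by (auto simp: E_def)
    show "H (t, z) = snd (t, z)" if "t \<in> {0..1}" "z \<in> N" "z \<in> E" for t z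
    proof -
      obtain x y where z: "z = (x, y)" "x \<in> C" using \<open>z \<in> N\<close> by (auto simp: N_def)
      have "\<eta> < dist x0 x" using \<open>z \<in> E\<close> z by (auto simp: E_def)
      then have "\<beta> x y = 0" using zero_le_dist[of y0 y] unfolding \<beta>_def by linarith
      then show ?thesis using z hom(3) by (auto simp: H_def C_def)
    qed
  qed
  then have hg: "homot (M \<times> M) (M \<times> M) id (\<lambda>z. if z \<in> N then H (1, z) else z)" (is "homot _ _ _ ?g")
    by (rule homotopic_with_eq) (auto simp: H_def N_def C_def hom(3))
  have dec: "dist (fst (?g (x, y))) (snd (?g (x, y))) < dist x y"
    if xC: "x \<in> C" and y: "y \<in> M" and pos: "\<beta> x y > 0" for x y
  proof -
    \<comment> \<open>The squared distance is differentiable even where the points meet, and its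
      derivative stays negative during the whole step.\<close>
    define q where "q s = (\<psi> (\<phi> x + s *\<^sub>R u) - y) \<bullet> (\<psi> (\<phi> x + s *\<^sub>R u) - y)" for s
    have yb: "y \<in> ball y0 r"
      using pos \<eta>(2) r(1) zero_le_dist[of x0 x] unfolding \<beta>_def mem_ball by linarith
    have "q (\<beta> x y) < q 0"
    proof (rule DERIV_neg_imp_decreasing[OF pos])
      fix s assume s: "0 \<le> s" "s \<le> \<beta> x y"
      define \<xi> where "\<xi> = \<phi> x + s *\<^sub>R u"
      have \<xi>: "\<xi> \<in> ball b r" using inb(1)[OF xC s(1)] s(2) \<beta>(2)[of x y] by (simp add: \<xi>_def)
      have "((\<lambda>s. \<phi> x + s *\<^sub>R u) has_derivative (\<lambda>s. s *\<^sub>R u)) (at s)"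
        by (auto intro!: derivative_eq_intros)
      from has_derivative_compose[OF this, of \<psi> "?D \<xi>"] D\<psi>[of \<xi>] \<xi> rV
      have "((\<lambda>s. \<psi> (\<phi> x + s *\<^sub>R u)) has_derivative (\<lambda>t. ?D \<xi> (t *\<^sub>R u))) (at s)"
        by (auto simp: \<xi>_def)
      then have "(q has_derivative (\<lambda>t. (\<psi> \<xi> - y) \<bullet> ?D \<xi> (t *\<^sub>R u) + ?D \<xi> (t *\<^sub>R u) \<bullet> (\<psi> \<xi> - y))) (at s)"
        unfolding q_def \<xi>_def by (auto intro!: derivative_eq_intros)
      moreover have "?D \<xi> (t *\<^sub>R u) = t *\<^sub>R ?D \<xi> u" for t
        using linear_cmul[OF lin] \<xi> rV by blast
      ultimately have "(q has_derivative (\<lambda>t. (2 * (?D \<xi> u \<bullet> (\<psi> \<xi> - y))) * t)) (at s)"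
        by (simp add: inner_commute algebra_simps)
      then have "DERIV q s :> 2 * (?D \<xi> u \<bullet> (\<psi> \<xi> - y))"
        by (simp add: has_field_derivative_def)
      then show "\<exists>y. DERIV q s :> y \<and> y < 0" using Gneg[OF \<xi> yb] by force
    qed
    then have "(dist (\<psi> (\<phi> x + \<beta> x y *\<^sub>R u)) y)\<^sup>2 < (dist x y)\<^sup>2"
      using xC hom(3) by (simp add: q_def C_def dist_norm power2_norm_eq_inner)
    then have "dist (\<psi> (\<phi> x + \<beta> x y *\<^sub>R u)) y < dist x y"
      using power_less_imp_less_base zero_le_dist by blast
    then show ?thesis using xC y by (simp add: N_def H_def)
  qed
  have "?g z = z \<or> dist (fst (?g z)) (snd (?g z)) < dist (fst z) (snd z)" if z: "z \<in> M \<times> M" for z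
  proof (cases "fst z \<in> C \<and> \<beta> (fst z) (snd z) > 0")
    case True
    then show ?thesis using dec[of "fst z" "snd z"] z by auto
  next
    case False
    then have "z \<notin> N \<or> \<beta> (fst z) (snd z) = 0" using \<beta>(1) by (auto simp: N_def less_le)
    then show ?thesis using hom(3) by (auto simp: H_def N_def C_def)
  qed
  then have "descends (M \<times> M) (\<lambda>z. dist (fst z) (snd z)) ?g"
    using hg by (simp add: descends_def)
  moreover have "\<beta> x0 y0 > 0" using \<eta>(1) by (simp add: \<beta>_def)
  then have "?g (x0, y0) \<noteq> (x0, y0)" using dec[OF x0C y0] by force
  ultimately show ?thesis by blast
qed

text \<open>Pushes move only the first coordinate; conjugation with the swap turns them into pushes
  of the second.\<close>

lemma descends_swap:
  assumes g: "descends (M \<times> M) f g" and f: "\<And>x y. f (y, x) = f (x, y)"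
  shows "descends (M \<times> M) f (prod.swap \<circ> g \<circ> prod.swap)"
proof -
  have c: "continuous_on (M \<times> M) prod.swap" "prod.swap \<in> M \<times> M \<rightarrow> M \<times> M"
    unfolding prod.swap_def by (intro continuous_intros) auto
  have hg: "homot (M \<times> M) (M \<times> M) id g" using g by (simp add: descends_def)
  have "homot (M \<times> M) (M \<times> M) (prod.swap \<circ> id) (prod.swap \<circ> g)"
    by (rule homotopic_with_compose_continuous_left[OF _ c]) (use hg in simp)
  then have "homot (M \<times> M) (M \<times> M) (prod.swap \<circ> id \<circ> prod.swap) (prod.swap \<circ> g \<circ> prod.swap)"
    by (intro homotopic_with_compose_continuous_right[OF _ c]) simp
  moreover have "prod.swap \<circ> id \<circ> prod.swap = id" by (auto simp: fun_eq_iff)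
  ultimately have "homot (M \<times> M) (M \<times> M) id (prod.swap \<circ> g \<circ> prod.swap)" by simp
  moreover have fs: "f (prod.swap z) = f z" for z using f by (cases z) auto
  have "(prod.swap \<circ> g \<circ> prod.swap) z = z \<or> f ((prod.swap \<circ> g \<circ> prod.swap) z) < f z"
    if "z \<in> M \<times> M" for z
  proof -
    have "prod.swap z \<in> M \<times> M" using that by auto
    then have "g (prod.swap z) = prod.swap z \<or> f (g (prod.swap z)) < f (prod.swap z)"
      by (rule bspec[OF conjunct2[OF g[unfolded descends_def]]])
    then show ?thesis using fs fs[of "g (prod.swap z)"] by auto
  qed
  ultimately show ?thesis by (simp add: descends_def)
qed

text \<open>If no tangent vector at x or y has a component along x - y, both tangent spaces are the
  hyperplane orthogonal to it and the pair is a double normal. Otherwise one of the two points can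
  be pushed.\<close>

lemma descends_not_double_normal:
  fixes M :: "'a::euclidean_space set"
  assumes M: "smooth_hypersurface M" and xy: "x \<in> M" "y \<in> M" "x \<noteq> y"
    and no: "\<not> (tangent_space M x = tangent_space M y \<and> tangent_space M y = {x - y}\<^sup>\<bottom>)"
  shows "\<exists>g. descends (M \<times> M) (\<lambda>z. dist (fst z) (snd z)) g \<and> g (x, y) \<noteq> (x, y)"
proof -
  have "\<exists>v. v \<bullet> (x - y) \<noteq> 0 \<and> (v \<in> tangent_space M x \<or> v \<in> tangent_space M y)"
  proof (rule ccontr)
    assume *: "\<not> ?thesis"
    then have "tangent_space M x = {x - y}\<^sup>\<bottom>"
      using xy by (intro tangent_space_hyperplane[OF M]) auto
    moreover have "tangent_space M y = {x - y}\<^sup>\<bottom>"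
      using xy * by (intro tangent_space_hyperplane[OF M]) auto
    ultimately show False using no by simp
  qed
  then obtain v where v: "v \<bullet> (x - y) \<noteq> 0" "v \<in> tangent_space M x \<or> v \<in> tangent_space M y" by blast
  show ?thesis
  proof (cases "v \<in> tangent_space M x")
    case True
    then show ?thesis using descends_push[OF M xy(1,2)] v(1) by blast
  next
    case False
    then have "v \<in> tangent_space M y" "v \<bullet> (y - x) \<noteq> 0"
      using v by (auto simp: inner_diff_right)
    then obtain g where g: "descends (M \<times> M) (\<lambda>z. dist (fst z) (snd z)) g" "g (y, x) \<noteq> (y, x)"
      using descends_push[OF M xy(2,1)] by blast
    have "descends (M \<times> M) (\<lambda>z. dist (fst z) (snd z)) (prod.swap \<circ> g \<circ> prod.swap)"
      by (rule descends_swap[OF g(1)]) (simp add: dist_commute)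
    moreover have "(prod.swap \<circ> g \<circ> prod.swap) (x, y) \<noteq> (x, y)"
      using g(2) by (cases "g (y, x)") auto
    ultimately show ?thesis by blast
  qed
qed

section \<open>Counting double normals\<close>

text \<open>Ordered pairs, since these are the critical points in M \<times> M.\<close>

definition double_normals :: "'a::euclidean_space set \<Rightarrow> ('a \<times> 'a) set" where
  "double_normals M = {(x, y). x \<in> M \<and> y \<in> M \<and> x \<noteq> y \<and>
     tangent_space M x = tangent_space M y \<and> tangent_space M y = {x - y}\<^sup>\<bottom>}"

proposition topological_complexity_le_double_normal_lengths:
  fixes M :: "'a::euclidean_space set"
  assumes M: "smooth_hypersurface M" "compact M" "connected M" and fin: "finite (double_normals M)"
  shows "topological_complexity (top_of_set M) \<le>
     enat (Suc (card ((\<lambda>z. dist (fst z) (snd z)) ` double_normals M)))"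
proof -
  let ?f = "\<lambda>z::'a \<times> 'a. dist (fst z) (snd z)"
  \<comment> \<open>The inserted 0 is the value on the diagonal.\<close>
  define D where "D = insert 0 (?f ` double_normals M)"
  have charts: "convex_charts M" using M(1) smooth_submanifold_convex_charts
    unfolding smooth_hypersurface_def by blast
  have pc: "path_connected M" using convex_charts_path_connected[OF charts M(3)] .
  have cf: "continuous_on (M \<times> M) ?f" by (intro continuous_intros)
  have D: "finite D" using fin by (simp add: D_def)
  have push: "\<exists>g. descends (M \<times> M) ?f g \<and> g z \<noteq> z"
    if "z \<in> M \<times> M" "?f z \<noteq> 0" "z \<notin> double_normals M" for z
    using that descends_not_double_normal[OF M(1), of "fst z" "snd z"]
    by (cases z) (auto simp: double_normals_def)
  have lev: "\<exists>W. openin (top_of_set (M \<times> M)) W \<and> motion_plannable M W \<and>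
         (\<forall>z\<in>M \<times> M. ?f z = d \<longrightarrow> z \<in> W \<or> (\<exists>g. descends (M \<times> M) ?f g \<and> g z \<noteq> z))" for d
  proof (cases "d = 0")
    case True
    obtain W where "openin (top_of_set (M \<times> M)) W" "\<And>x. x \<in> M \<Longrightarrow> (x, x) \<in> W" "motion_plannable M W"
      using motion_plannable_diagonal[OF charts M(2)] by blast
    then show ?thesis using True by (intro exI[of _ W]) auto
  next
    \<comment> \<open>One neighbourhood of all double normals serves every positive level.\<close>
    case False
    have "double_normals M \<subseteq> M \<times> M" by (auto simp: double_normals_def)
    then obtain W where "openin (top_of_set (M \<times> M)) W" "double_normals M \<subseteq> W" "motion_plannable M W"
      using motion_plannable_finite[OF charts pc fin] by blast
    then show ?thesis using False push by (intro exI[of _ W]) blast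
  qed
  have "bounded (?f ` (M \<times> M))"
    using M(2) cf by (intro compact_imp_bounded compact_continuous_image) (auto simp: compact_Times)
  \<comment> \<open>At a level c that bounds the distance, the sublevel set is all of M \<times>
    M.\<close>
  then obtain c where "\<forall>d\<in>?f ` (M \<times> M). \<bar>d\<bar> \<le> c"
    unfolding bounded_real by (rule exE)
  then have c: "?f z \<le> c" if "z \<in> M \<times> M" for z
    using abs_le_D1 that by fast
  have "planner_cover M (card {d \<in> D. d \<le> c}) {z \<in> M \<times> M. ?f z \<le> c}"
  proof (rule planner_cover_sublevel[OF M(2) cf D lev])
    fix z assume z: "z \<in> M \<times> M" "?f z \<notin> D"
    then have "?f z \<noteq> 0" "z \<notin> double_normals M" by (auto simp: D_def)
    then show "\<exists>g. descends (M \<times> M) ?f g \<and> g z \<noteq> z" using push z(1) by blast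
  qed
  moreover have "card {d \<in> D. d \<le> c} \<le> card D" using D by (intro card_mono) auto
  moreover have "card D \<le> Suc (card (?f ` double_normals M))" by (simp add: D_def card_insert_le_m1 card_insert_if fin)
  ultimately have "planner_cover M (Suc (card (?f ` double_normals M))) (M \<times> M)"
    using c by (elim planner_cover_mono) auto
  then show ?thesis by (rule topological_complexity_le)
qed

definition double_normal_pairs :: "'a::euclidean_space set \<Rightarrow> 'a set set" where
  "double_normal_pairs M = {{x, y} | x y. x \<in> M \<and> y \<in> M \<and> x \<noteq> y \<and>
              tangent_space M x = tangent_space M y \<and>
              tangent_space M y = {x - y}\<^sup>\<bottom>}"

lemma double_normal_pairs_image: "double_normal_pairs M = (\<lambda>z. {fst z, snd z}) ` double_normals M"
proof (intro set_eqI iffI)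
  fix S assume "S \<in> double_normal_pairs M"
  then obtain x y where "S = {x, y}" "(x, y) \<in> double_normals M"
    unfolding double_normal_pairs_def double_normals_def by auto
  then show "S \<in> (\<lambda>z. {fst z, snd z}) ` double_normals M" by (intro image_eqI[of _ _ "(x, y)"]) auto
next
  fix S assume "S \<in> (\<lambda>z. {fst z, snd z}) ` double_normals M"
  then obtain x y where "S = {x, y}" "(x, y) \<in> double_normals M" by auto
  then show "S \<in> double_normal_pairs M"
    unfolding double_normal_pairs_def double_normals_def by blast
qed

text \<open>Both orderings of a pair have the same length, so lengths are a function of unordered
  pairs and there are at most as many of them.\<close>

lemma card_double_normal_lengths:
  assumes fin: "finite (double_normal_pairs M)"
  shows "finite (double_normals M)"
    and "card ((\<lambda>z. dist (fst z) (snd z)) ` double_normals M) \<le> card (double_normal_pairs M)"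
proof -
  have "double_normals M \<subseteq> \<Union>(double_normal_pairs M) \<times> \<Union>(double_normal_pairs M)"
  proof
    fix z assume "z \<in> double_normals M"
    then have "{fst z, snd z} \<in> double_normal_pairs M" by (simp add: double_normal_pairs_image)
    then show "z \<in> \<Union>(double_normal_pairs M) \<times> \<Union>(double_normal_pairs M)" by (cases z) auto
  qed
  moreover have "finite (\<Union>(double_normal_pairs M))"
    using fin by (auto simp: double_normal_pairs_image)
  ultimately show "finite (double_normals M)" using finite_subset finite_cartesian_product by blast
  \<comment> \<open>Well defined because a doubleton determines its two points up to order and
    \<open>dist\<close> is symmetric.\<close>
  define \<delta> :: "'a set \<Rightarrow> real" where "\<delta> S = (THE d. \<exists>x y. S = {x, y} \<and> d = dist x y)" for S
  have \<delta>: "\<delta> {x, y} = dist x y" for x y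
    unfolding \<delta>_def by (rule the_equality) (auto simp: doubleton_eq_iff dist_commute)
  have "(\<lambda>z. dist (fst z) (snd z)) ` double_normals M = \<delta> ` double_normal_pairs M"
    by (simp add: double_normal_pairs_image image_image \<delta>)
  then show "card ((\<lambda>z. dist (fst z) (snd z)) ` double_normals M) \<le> card (double_normal_pairs M)"
    using fin card_image_le by metis
qed

lemma ecard_mono: "A \<subseteq> B \<Longrightarrow> ecard A \<le> ecard B"
  by (auto simp: ecard_def card_mono dest: finite_subset)

theorem theorem3p5:
  fixes M :: "(real ^ 'n) set"
  assumes "smooth_hypersurface M" "compact M" "connected M"
  shows "double_normal_count M \<ge> topological_complexity (top_of_set M) - 1 \<and>
         ecard {{x, y} | x y. x \<in> M \<and> y \<in> M \<and> x \<noteq> y \<and>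
                  tangent_space M x = tangent_space M y}
         \<ge> topological_complexity (top_of_set M) - 1"
proof -
  have eq: "double_normal_count M = ecard (double_normal_pairs M)"
    by (simp add: double_normal_count_def double_normal_pairs_def)
  have main: "topological_complexity (top_of_set M) - 1 \<le> ecard (double_normal_pairs M)"
  \<comment> \<open>For infinitely many pairs the right-hand side is \<infinity>.\<close>
  proof (cases "finite (double_normal_pairs M)")
    case True
    then have "topological_complexity (top_of_set M) \<le> enat (Suc (card (double_normal_pairs M)))"
      by (intro order_trans[OF topological_complexity_le_double_normal_lengths[OF assms]])
        (simp_all add: card_double_normal_lengths)
    then show ?thesis
      using True by (cases "topological_complexity (top_of_set M)") (auto simp: ecard_def one_enat_def)
  qed (simp add: ecard_def)
  have "double_normal_pairs M \<subseteq> {{x, y} | x y. x \<in> M \<and> y \<in> M \<and> x \<noteq> y \<and>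
                  tangent_space M x = tangent_space M y}"
    unfolding double_normal_pairs_def by blast
  from order_trans[OF main ecard_mono[OF this]] show ?thesis using main eq by simp
qed

end
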